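(* Let $w$ be the weight system on the lecture hall graph defined, for $m\ge0$ and $0\le j\le i$, by \[ w(t;i,j)=(abq^{2i+2})^m q^j\times\begin{cases} cq & \text{if } t=4m,\\ aq & \text{if } t=4m+1,\\ -acq^{i+2} & \text{if } t=4m+2,\\ -abq^{i+2} & \text{if } t=4m+3.\end{cases} \] Then the mixed moments $\sigma^B_{n,k}(a,b,c;q)$ of the big $q$-Jacobi polynomials satisfy \[ \sigma^B_{n,k}(a,b,c;q)=h^w_{n,k}\qquad(n\ge k\ge0). \]
   Context: Lecture hall graph. For integers $t\ge0$, $0\le j\le i$ put $v^t_{i,j}=(i,\,t+\frac{j}{i+1})$, and set $v^t_{i,i+1}:=v^{t+1}_{i,0}$. The vertices of the lecture hall graph are all $v^t_{i,j}$; its edges join $v^t_{i,j}$ with $v^t_{i,j+1}$ (vertical edges) and $v^t_{i,j}$ with $v^t_{i+1,j}$, for $t\ge 0$, $0\le j\le i$. An east step is a directed edge $(v^t_{i,j},v^t_{i+1,j})$; a south step is a vertical edge directed downwards, $(v^t_{i,j+1},v^t_{i,j})$. A weight system $w$ assigns a weight $w(t;i,j)$ to each east step $(v^t_{i,j},v^t_{i+1,j})$. The weight $w(p)$ of a path is the product of the weights of its east steps. $\mathrm{SE}((k,\infty)\to(n,0))$ is the set of paths $(\dots,v_2,v_1,v_0)$ with $v_0=(n,0)$, $\lim_{m\to\infty}v_m=(k,\infty)$, and each $(v_{m+1},v_m)$ a south or east step. Define $h^w_{n,k}=\sum_{p\in \mathrm{SE}((k,\infty)\to(n,0))}w(p)$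 (so $h^w_{n,n}=1$). Big $q$-Jacobi polynomials. The monic big $q$-Jacobi polynomials are \[ p_n(x;a,b,c;q)=\frac{(aq,cq;q)_n}{(abq^{n+1};q)_n}\;{}_3\phi_2\!\left(\begin{matrix} q^{-n},\, abq^{n+1},\, x \\ aq,\, cq \end{matrix};q,q\right), \] where ${}_3\phi_2(\alpha_1,\alpha_2,\alpha_3;\beta_1,\beta_2;q,z)=\sum_{k\ge0}\frac{(\alpha_1,\alpha_2,\alpha_3;q)_k}{(q,\beta_1,\beta_2;q)_k}z^k$, $(z;q)_k=\prod_{i=0}^{k-1}(1-zq^i)$, $(z_1,\dots,z_r;q)_k=\prod_s(z_s;q)_k$. The mixed moments are defined by $x^n=\sum_{k=0}^n\sigma^B_{n,k}(a,b,c;q)\,p_k(x;a,b,c;q)$. Here $a,b,c,q$ are indeterminates, and the identity is one of formal power series in $a,b,c$ with coefficients in $\mathbb{Q}(q)$ (the infinite sum $h^w_{n,k}$ gives the power series expansion of $\sigma^B_{n,k}$). *)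

theory Defs
  imports
    Complex_Main
    "HOL-Library.Groups_Big_Fun"
    "HOL-Computational_Algebra.Computational_Algebra"
begin

section \<open>Formal power series in three variables over the rational functions\<close>

text \<open>
  The coefficient field is Q(q), the fraction field of Q[q]; the ring of formal power series
  Q(q)[[a,b,c]] is rendered as Q(q)[[a]][[b]][[c]], so the innermost series variable is a.
\<close>

type_synonym ser = "rat poly fract fps fps fps"

definition scal :: "rat poly fract \<Rightarrow> ser" where
  "scal r = fps_const (fps_const (fps_const r))"

definition q0 :: "rat poly fract" where "q0 = Fract [:0, 1:] 1"

definition qq :: ser where "qq = scal q0"
definition aa :: ser where "aa = fps_const (fps_const fps_X)"
definition bb :: ser where "bb = fps_const fps_X"
definition cc :: ser where "cc = fps_X"

definition coeff3 :: "ser \<Rightarrow> nat \<Rightarrow> nat \<Rightarrow> nat \<Rightarrow> rat poly fract" where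
  "coeff3 f i j l = fps_nth (fps_nth (fps_nth f l) j) i"

text \<open>
  Infinite sums of formal power series are taken coefficientwise. The metric topology of the
  library on iterated series is not used: it is adic in the outermost variable only, whereas
  here every single coefficient has to receive finitely many contributions.
\<close>

definition formally_summable :: "('p \<Rightarrow> ser) \<Rightarrow> 'p set \<Rightarrow> bool" where
  "formally_summable f A \<longleftrightarrow> (\<forall>i j l. finite {x \<in> A. coeff3 (f x) i j l \<noteq> 0})"

definition formal_sum :: "('p \<Rightarrow> ser) \<Rightarrow> 'p set \<Rightarrow> ser" where
  "formal_sum f A = Abs_fps (\<lambda>l. Abs_fps (\<lambda>j. Abs_fps (\<lambda>i.
     \<Sum>x\<in>{x \<in> A. coeff3 (f x) i j l \<noteq> 0}. coeff3 (f x) i j l)))"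

text \<open>
  The library inverse on iterated series is a true inverse as soon as the constant term is
  nonzero, which is the case for all denominators occurring below.
\<close>

lemma inverse_ser:
  fixes f :: ser
  assumes "coeff3 f 0 0 0 \<noteq> 0"
  shows "inverse f * f = 1"
proof -
  have 1: "inverse (f $ 0 $ 0) * (f $ 0 $ 0) = 1"
    using assms by (intro inverse_mult_eq_1) (simp add: coeff3_def)
  have 2: "inverse (f $ 0) * (f $ 0) = 1"
    unfolding fps_inverse_def[of "f $ 0"]
    using fps_right_inverse[OF 1[unfolded mult.commute[of "inverse (f $ 0 $ 0)"]]]
    by (simp add: mult.commute)
  show ?thesis
    unfolding fps_inverse_def[of f]
    using fps_right_inverse[OF 2[unfolded mult.commute[of "inverse (f $ 0)"]]]
    by (simp add: mult.commute)
qed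


section \<open>The lecture hall graph\<close>

text \<open>
  Vertices are points of the plane, so that the convention identifying \<open>lhv t i (i + 1)\<close> with
  \<open>lhv (t + 1) i 0\<close> is an equality of points.
\<close>

definition lhv :: "nat \<Rightarrow> nat \<Rightarrow> nat \<Rightarrow> nat \<times> real" where
  "lhv t i j = (i, real t + real j / real (i + 1))"

lemma lhv_wrap: "lhv t i (i + 1) = lhv (t + 1) i 0"
  by (simp add: lhv_def)

definition east_step :: "nat \<times> real \<Rightarrow> nat \<times> real \<Rightarrow> bool" where
  "east_step u v \<longleftrightarrow> (\<exists>t i j. j \<le> i \<and> u = lhv t i j \<and> v = lhv t (i + 1) j)"

definition south_step :: "nat \<times> real \<Rightarrow> nat \<times> real \<Rightarrow> bool" where
  "south_step u v \<longleftrightarrow> (\<exists>t i j. j \<le> i \<and> u = lhv t i (j + 1) \<and> v = lhv t i j)"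

text \<open>A weight system is a function \<open>w t i j\<close>; only its values with \<open>j \<le> i\<close> matter.\<close>

definition east_weight :: "(nat \<Rightarrow> nat \<Rightarrow> nat \<Rightarrow> 'a) \<Rightarrow> nat \<times> real \<Rightarrow> nat \<times> real \<Rightarrow> 'a" where
  "east_weight w u v =
     (THE x. \<exists>t i j. j \<le> i \<and> u = lhv t i j \<and> v = lhv t (i + 1) j \<and> x = w t i j)"

lemma lhv_inj:
  assumes "lhv t i j = lhv t' i' j'" "j \<le> i" "j' \<le> i'"
  shows "t = t' \<and> i = i' \<and> j = j'"
proof -
  have i: "i' = i" using assms(1) by (simp add: lhv_def)
  have fl: "\<lfloor>real s + real k / real (i + 1)\<rfloor> = int s" if "k \<le> i" for s k
    using that by (intro floor_unique) (auto simp: field_simps)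
  have eq: "real t + real j / real (i + 1) = real t' + real j' / real (i + 1)"
    using assms(1) by (simp add: lhv_def i)
  have "int t = int t'" using fl[of j t] fl[of j' t'] assms(2,3) eq i by metis
  thus ?thesis using eq i by simp
qed

lemma east_weight_lhv:
  assumes "j \<le> i"
  shows "east_weight w (lhv t i j) (lhv t (i + 1) j) = w t i j"
  unfolding east_weight_def
proof (rule the_equality)
  show "\<exists>t' i' j'. j' \<le> i' \<and> lhv t i j = lhv t' i' j' \<and>
      lhv t (i + 1) j = lhv t' (i' + 1) j' \<and> w t i j = w t' i' j'"
    using assms by blast
next
  fix x
  assume "\<exists>t' i' j'. j' \<le> i' \<and> lhv t i j = lhv t' i' j' \<and>
      lhv t (i + 1) j = lhv t' (i' + 1) j' \<and> x = w t' i' j'"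
  thus "x = w t i j" using assms lhv_inj by metis
qed

text \<open>
  A path \<open>(\<dots>, v\<^sub>2, v\<^sub>1, v\<^sub>0)\<close> is the sequence \<open>p m = v\<^sub>m\<close>, indexed backwards from its end point.
  The limit \<open>(k, \<infinity>)\<close> is taken componentwise, the first component in the discrete space of
  natural numbers.
\<close>

definition SE :: "nat \<Rightarrow> nat \<Rightarrow> (nat \<Rightarrow> nat \<times> real) set" where
  "SE k n = {p. p 0 = (n, 0) \<and>
     (\<forall>m. south_step (p (Suc m)) (p m) \<or> east_step (p (Suc m)) (p m)) \<and>
     ((\<lambda>m. fst (p m)) \<longlonglongrightarrow> k) \<and> filterlim (\<lambda>m. snd (p m)) at_top sequentially}"

definition path_weight ::
  "(nat \<Rightarrow> nat \<Rightarrow> nat \<Rightarrow> 'a::comm_monoid_mult) \<Rightarrow> (nat \<Rightarrow> nat \<times> real) \<Rightarrow> 'a" where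
  "path_weight w p = (\<Prod>m\<in>{m. east_step (p (Suc m)) (p m)}. east_weight w (p (Suc m)) (p m))"

text \<open>The product above is finite.\<close>

lemma finite_east_steps:
  assumes "p \<in> SE k n"
  shows "finite {m. east_step (p (Suc m)) (p m)}"
proof -
  have step: "fst (p (Suc m)) \<le> fst (p m)" for m
    using assms by (auto simp: SE_def south_step_def east_step_def lhv_def
        dest!: spec[of _ m])
  have mono: "fst (p m') \<le> fst (p m)" if "m \<le> m'" for m m'
    using lift_Suc_antimono_le[of "\<lambda>m. fst (p m)", OF step that] .
  have strict: "fst (p (Suc m)) < fst (p m)" if "east_step (p (Suc m)) (p m)" for m
    using that by (auto simp: east_step_def lhv_def)
  have lt: "fst (p m') < fst (p m)" if "m < m'" "east_step (p (Suc m)) (p m)" for m m'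
    using strict[OF that(2)] mono[of "Suc m" m'] that(1) by linarith
  have "inj_on (\<lambda>m. fst (p m)) {m. east_step (p (Suc m)) (p m)}"
    by (rule inj_onI) (metis lt less_irrefl linorder_neqE_nat mem_Collect_eq)
  moreover have "(\<lambda>m. fst (p m)) ` {m. east_step (p (Suc m)) (p m)} \<subseteq> {..fst (p 0)}"
    using mono by auto
  ultimately show ?thesis
    using finite_imageD finite_subset finite_atMost by blast
qed

definition h :: "(nat \<Rightarrow> nat \<Rightarrow> nat \<Rightarrow> ser) \<Rightarrow> nat \<Rightarrow> nat \<Rightarrow> ser" where
  "h w n k = formal_sum (path_weight w) (SE k n)"


section \<open>Big q-Jacobi polynomials and their mixed moments\<close>

definition qpoch :: "'a::comm_ring_1 \<Rightarrow> 'a \<Rightarrow> nat \<Rightarrow> 'a" where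
  "qpoch z q k = (\<Prod>i<k. 1 - z * q ^ i)"

text \<open>
  The numerator parameters are polynomials in x over Q(q)[[a,b,c]], the denominator ones are
  series. The sum is over all indices with nonzero summand; it is only used where the series
  terminates.
\<close>

definition phi32 ::
  "ser poly \<Rightarrow> ser poly \<Rightarrow> ser poly \<Rightarrow> ser \<Rightarrow> ser \<Rightarrow> ser \<Rightarrow> ser \<Rightarrow> ser poly" where
  "phi32 \<alpha>\<^sub>1 \<alpha>\<^sub>2 \<alpha>\<^sub>3 \<beta>\<^sub>1 \<beta>\<^sub>2 q z = Sum_any (\<lambda>k.
     smult (inverse (qpoch q q k * qpoch \<beta>\<^sub>1 q k * qpoch \<beta>\<^sub>2 q k))
       (qpoch \<alpha>\<^sub>1 [:q:] k * qpoch \<alpha>\<^sub>2 [:q:] k * qpoch \<alpha>\<^sub>3 [:q:] k) * [:z:] ^ k)"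

definition big_q_Jacobi :: "nat \<Rightarrow> ser poly" where
  "big_q_Jacobi n =
     smult (qpoch (aa * qq) qq n * qpoch (cc * qq) qq n *
            inverse (qpoch (aa * bb * qq ^ (n + 1)) qq n))
       (phi32 [:scal (inverse (q0 ^ n)):] [:aa * bb * qq ^ (n + 1):] [:0, 1:]
          (aa * qq) (cc * qq) qq qq)"

text \<open>The n-th row of coefficients is extended by 0 to indices \<open>k > n\<close> to make it unique.\<close>

definition mixed_moment :: "nat \<Rightarrow> nat \<Rightarrow> ser" where
  "mixed_moment n = (THE s. (\<forall>k>n. s k = 0) \<and>
     [:0, 1:] ^ n = (\<Sum>k\<le>n. smult (s k) (big_q_Jacobi k)))"


section \<open>The weight system\<close>

definition wt :: "nat \<Rightarrow> nat \<Rightarrow> nat \<Rightarrow> ser" where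
  "wt t i j = (aa * bb * qq ^ (2 * i + 2)) ^ (t div 4) * qq ^ j *
     (if t mod 4 = 0 then cc * qq
      else if t mod 4 = 1 then aa * qq
      else if t mod 4 = 2 then - (aa * cc * qq ^ (i + 2))
      else - (aa * bb * qq ^ (i + 2)))"

end

theory Submission
  imports Defs
begin

text \<open>
  Cutting a path at the heights \<open>0, 1, 2, \<dots>\<close> factors the matrix \<open>h\<close> into an infinite product of
  level matrices \<open>G\<^sub>t\<close>, whose entries are q-binomial coefficients times powers of the weight.
  The big q-Jacobi polynomials are the eigenvectors of a second order q-difference operator,
  which is a three-banded matrix \<open>M\<close> in the basis of monomials. Two successive levels transform
  \<open>M\<close> into an operator of the same shape with other parameters, and four of them give
  \<open>M G\<^sub>0 G\<^sub>1 G\<^sub>2 G\<^sub>3 = G\<^sub>0 G\<^sub>1 G\<^sub>2 G\<^sub>3 M'\<close>, where the off-diagonal part of \<open>M'\<close> has gained a factor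
  \<open>ab\<close>. Iterating, that part vanishes a-adically, so every column of \<open>h\<close> is an eigenvector of
  \<open>M\<close>. As the eigenvalues are distinct, the sum of \<open>h\<^sub>n\<^sub>,\<^sub>k p\<^sub>k\<close> over \<open>k\<close> equals \<open>x\<^sup>n\<close>, by induction on \<open>n\<close>.
\<close>

section \<open>Operators attached to the levels of the lecture hall graph\<close>

fun qbin :: "'a::comm_ring_1 \<Rightarrow> nat \<Rightarrow> nat \<Rightarrow> 'a" where
  "qbin q n 0 = 1"
| "qbin q 0 (Suc k) = 0"
| "qbin q (Suc n) (Suc k) = q ^ (n - k) * qbin q n k + qbin q n (Suc k)"

lemma qbin_eq_0: "n < k \<Longrightarrow> qbin q n k = 0"
  by (induction q n k rule: qbin.induct) auto

lemma qbin_self [simp]: "qbin q n n = 1"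
  by (induction n) (auto simp: qbin_eq_0)

text \<open>With \<open>a = q ^ Suc k\<close>, \<open>e = q ^ (n - k)\<close>,
  \<open>N = q ^ Suc n\<close>, the q-Pascal rule turns the relation of \<open>qbin_step\<close>
  into that of \<open>qbin_absorb\<close>.\<close>

lemma absorb_arith:
  fixes a e x y N :: "'a::comm_ring_1"
  assumes "(1 - a) * y = (1 - e) * x" "a * e = N"
  shows "(1 - a) * (e * x + y) = (1 - N) * x"
proof -
  have "(1 - a) * (e * x + y) = e * x - (a * e) * x + (1 - a) * y"
    by (simp add: algebra_simps)
  then show ?thesis
    unfolding assms by (simp add: algebra_simps)
qed

text \<open>Ratio of neighbours in a row, cleared of denominators. In the induction step both sides
  become \<open>(1 - q ^ Suc n) * qbin q n k\<close>.\<close>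

lemma qbin_step:
  "k \<le> n \<Longrightarrow> (1 - q ^ Suc k) * qbin q n (Suc k) = (1 - q ^ (n - k)) * qbin q n k"
proof (induction n arbitrary: k)
  case 0
  then show ?case by simp
next
  case (Suc n)
  have absorb: "(1 - q ^ Suc j) * qbin q (Suc n) (Suc j) = (1 - q ^ Suc n) * qbin q n j" if "j \<le> n" for j
  proof -
    have "q ^ Suc j * q ^ (n - j) = q ^ Suc n"
      using that by (simp del: power_Suc flip: power_add)
    then show ?thesis
      unfolding qbin.simps(3) using Suc.IH[OF that] by (intro absorb_arith)
  qed
  show ?case
  proof (cases k)
    case 0
    then show ?thesis using absorb[of 0] by simp
  next
    case (Suc j)
    then have j: "j \<le> n" using Suc.prems by simp
    have pw: "q ^ (n - j) * q ^ Suc j = q ^ Suc n"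
      using j by (simp del: power_Suc flip: power_add)
    have "(1 - q ^ (n - j)) * qbin q (Suc n) (Suc j)
        = q ^ (n - j) * ((1 - q ^ (n - j)) * qbin q n j) + (1 - q ^ (n - j)) * qbin q n (Suc j)"
      by (simp add: algebra_simps)
    also have "\<dots> = (1 - q ^ (n - j) * q ^ Suc j) * qbin q n (Suc j)"
      unfolding Suc.IH[OF j, symmetric] by (simp add: algebra_simps)
    finally have A: "(1 - q ^ (n - j)) * qbin q (Suc n) (Suc j) = (1 - q ^ Suc n) * qbin q n (Suc j)"
      unfolding pw .
    show ?thesis
    proof (cases "j = n")
      case True
      then show ?thesis using Suc by (simp add: qbin_eq_0)
    next
      case False
      then have "Suc j \<le> n" using j by simp
      from absorb[OF this] show ?thesis
        unfolding Suc diff_Suc_Suc A .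
    qed
  qed
qed

text \<open>The q-analogue of (k + 1) C(n + 1, k + 1) = (n + 1) C(n, k).\<close>

lemma qbin_absorb:
  "k \<le> n \<Longrightarrow> (1 - q ^ Suc k) * qbin q (Suc n) (Suc k) = (1 - q ^ Suc n) * qbin q n k"
proof -
  assume k: "k \<le> n"
  have "q ^ Suc k * q ^ (n - k) = q ^ Suc n"
    using k by (simp del: power_Suc flip: power_add)
  then show ?thesis
    unfolding qbin.simps(3) using qbin_step[OF k, of q] by (intro absorb_arith)
qed

section \<open>Level operators, weighted q-shifts and their commutation relations\<close>

context
  fixes q r :: "'a::comm_ring_1"
begin

text \<open>
  Operators act on columns, i.e. on functions of the row index \<open>n\<close>, so that their composition is
  the matrix product.
\<close>

definition level_op :: "(nat \<Rightarrow> 'a) \<Rightarrow> (nat \<Rightarrow> 'a) \<Rightarrow> nat \<Rightarrow> 'a" where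
  "level_op u f n = (\<Sum>m\<le>n. (\<Prod>i\<in>{m..<n}. u i) * qbin q n m * f m)"

text \<open>A subdiagonal matrix; with \<open>s = 1\<close> it maps the sequence of monomials to
  \<open>1 - q\<close> times their q-derivatives.\<close>

definition qshift :: "(nat \<Rightarrow> 'a) \<Rightarrow> (nat \<Rightarrow> 'a) \<Rightarrow> nat \<Rightarrow> 'a" where
  "qshift s f n = (case n of 0 \<Rightarrow> 0 | Suc m \<Rightarrow> s m * (1 - q ^ Suc m) * f m)"

lemma qshift_0 [simp]: "qshift s f 0 = 0"
  and qshift_Suc [simp]: "qshift s f (Suc m) = s m * (1 - q ^ Suc m) * f m"
  by (simp_all add: qshift_def)

lemma level_op_cmult: "level_op u (\<lambda>n. x * f n) = (\<lambda>n. x * level_op u f n)"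
  and level_op_add: "level_op u (\<lambda>n. f n + g n) = (\<lambda>n. level_op u f n + level_op u g n)"
  and level_op_diff: "level_op u (\<lambda>n. f n - g n) = (\<lambda>n. level_op u f n - level_op u g n)"
  by (simp_all add: fun_eq_iff level_op_def sum.distrib sum_subtractf sum_distrib_left algebra_simps)

lemma qshift_cmult: "qshift u (\<lambda>n. x * f n) = (\<lambda>n. x * qshift u f n)"
  and qshift_add: "qshift u (\<lambda>n. f n + g n) = (\<lambda>n. qshift u f n + qshift u g n)"
  and qshift_diff: "qshift u (\<lambda>n. f n - g n) = (\<lambda>n. qshift u f n - qshift u g n)"
  by (auto simp: fun_eq_iff qshift_def algebra_simps split: nat.split)

lemma prod_slide:
  fixes s :: "nat \<Rightarrow> 'a"
  assumes "k \<le> m"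
  shows "s m * (\<Prod>i\<in>{k..<m}. x * s i) = s k * (\<Prod>i\<in>{Suc k..<Suc m}. x * s i)"
proof (cases "k = m")
  case False
  then have "k < m" using assms by simp
  then show ?thesis
    by (simp add: prod.atLeast_Suc_lessThan[of k] mult_ac)
qed simp

text \<open>The level weights are a constant multiple of the shift weights, so
  \<open>prod_slide\<close> transports the weights and \<open>qbin_absorb\<close> the factors of the
  form 1 - q^n.\<close>

lemma level_op_qshift: "qshift s (level_op (\<lambda>i. x * s i) f) n = level_op (\<lambda>i. x * s i) (qshift s f) n"
proof (cases n)
  case 0
  then show ?thesis by (simp add: level_op_def)
next
  case (Suc m)
  have "s m * (1 - q ^ Suc m) * ((\<Prod>i\<in>{k..<m}. x * s i) * qbin q m k * f k) =
      (\<Prod>i\<in>{Suc k..<Suc m}. x * s i) * qbin q (Suc m) (Suc k) * (s k * (1 - q ^ Suc k) * f k)"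
    if "k \<le> m" for k
  proof -
    have "s m * (1 - q ^ Suc m) * ((\<Prod>i\<in>{k..<m}. x * s i) * qbin q m k * f k)
      = (s m * (\<Prod>i\<in>{k..<m}. x * s i)) * ((1 - q ^ Suc m) * qbin q m k) * f k"
      by (simp only: mult_ac)
    then show ?thesis
      unfolding prod_slide[OF that] qbin_absorb[OF that, symmetric]
      by (simp only: mult_ac)
  qed
  then have "s m * (1 - q ^ Suc m) * level_op (\<lambda>i. x * s i) f m
      = (\<Sum>k\<le>m. (\<Prod>i\<in>{Suc k..<Suc m}. x * s i) * qbin q (Suc m) (Suc k) * qshift s f (Suc k))"
    unfolding level_op_def sum_distrib_left by (intro sum.cong) (simp_all del: qbin.simps)
  also have "\<dots> = level_op (\<lambda>i. x * s i) (qshift s f) (Suc m)"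
    unfolding level_op_def by (subst sum.atMost_Suc_shift) (simp del: sum.atMost_Suc prod.op_ivl_Suc qbin.simps(3))
  finally show ?thesis using Suc by simp
qed

text \<open>For the level operator L this is T L = L (1 - x d) T, where T f n = q^n f n and d =
  \<open>qshift s\<close>. The k-th summand carries q^k - q^n = q^k (1 - q^(n - k)), which
  \<open>qbin_step\<close> moves to index k + 1.\<close>

lemma level_op_T:
  "q ^ n * level_op (\<lambda>i. x * s i) f n =
    level_op (\<lambda>i. x * s i) (\<lambda>n. q ^ n * f n) n - x * level_op (\<lambda>i. x * s i) (qshift s (\<lambda>n. q ^ n * f n)) n"
proof -
  let ?P = "\<lambda>m. \<Prod>i\<in>{m..<n}. x * s i"
  have "(q ^ k - q ^ n) * (?P k * qbin q n k * f k) =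
     x * (?P (Suc k) * qbin q n (Suc k) * qshift s (\<lambda>n. q ^ n * f n) (Suc k))" if "k < n" for k
  proof -
    have e: "(q ^ k - q ^ n) = q ^ k * (1 - q ^ (n - k))"
      using that by (simp add: algebra_simps flip: power_add)
    have "(q ^ k - q ^ n) * (?P k * qbin q n k * f k) = q ^ k * (?P k * f k) * ((1 - q ^ (n - k)) * qbin q n k)"
      by (simp add: e mult_ac)
    also have "\<dots> = q ^ k * (x * s k * ?P (Suc k) * f k) * ((1 - q ^ Suc k) * qbin q n (Suc k))"
      using that qbin_step[of k n q] by (simp add: prod.atLeast_Suc_lessThan[of k])
    finally show ?thesis by (simp add: mult_ac)
  qed
  then have "(\<Sum>k<n. (q ^ k - q ^ n) * (?P k * qbin q n k * f k)) =
     (\<Sum>k<n. x * (?P (Suc k) * qbin q n (Suc k) * qshift s (\<lambda>n. q ^ n * f n) (Suc k)))"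
    by (intro sum.cong) simp_all
  moreover have "level_op (\<lambda>i. x * s i) (\<lambda>n. q ^ n * f n) n - q ^ n * level_op (\<lambda>i. x * s i) f n
    = (\<Sum>k<n. (q ^ k - q ^ n) * (?P k * qbin q n k * f k))"
    unfolding level_op_def lessThan_Suc_atMost[symmetric]
    by (simp add: sum_distrib_left sum_subtractf algebra_simps)
  moreover have "x * level_op (\<lambda>i. x * s i) (qshift s (\<lambda>n. q ^ n * f n)) n =
     (\<Sum>k<n. x * (?P (Suc k) * qbin q n (Suc k) * qshift s (\<lambda>n. q ^ n * f n) (Suc k)))"
    unfolding level_op_def by (subst sum.atMost_shift) (simp add: sum_distrib_left)
  ultimately show ?thesis by (simp add: algebra_simps)
qed

text \<open>
  With \<open>T f n = q\<^sup>n f n\<close> and \<open>d = qshift s\<close>, \<open>band_op\<close> is \<open>T\<^sup>-\<^sup>1 (1 - x d) (1 - y d) - K + p T + z d\<close> and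
  \<open>band_conj\<close> is \<open>T\<^sup>-\<^sup>1 - K + p (1 - x d) (1 - y d) T + z d\<close>. A level operator commutes with \<open>d\<close> and
  moves one factor from the first term to the third.
\<close>

definition band_op where
  "band_op x y z p K s f n = r ^ n * (f n - (x + y) * qshift s f n + x * y * qshift s (qshift s f) n)
     - K * f n + p * (q ^ n * f n) + z * qshift s f n"

definition band_conj where
  "band_conj x y z p K s f n = r ^ n * f n - K * f n
     + p * (q ^ n * f n - (x + y) * qshift s (\<lambda>n. q ^ n * f n) n + x * y * qshift s (qshift s (\<lambda>n. q ^ n * f n)) n)
     + z * qshift s f n"

context
  assumes rq: "r * q = 1"
begin

lemma rq_pow: "r ^ n * q ^ n = 1" "q ^ n * r ^ n = 1" "r ^ n * (q ^ n * x) = x"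
  "q ^ n * (r ^ n * x) = x"
proof -
  show *: "r ^ n * q ^ n = 1" by (simp add: rq flip: power_mult_distrib)
  show "q ^ n * r ^ n = 1" using * by (simp add: mult.commute)
  show "r ^ n * (q ^ n * x) = x"
    using * by (metis mult.assoc mult_1)
  show "q ^ n * (r ^ n * x) = x"
    using * by (metis mult.assoc mult.commute mult_1)
qed

text \<open>Applying \<open>level_op_T\<close> to T^-1 f gives T^-1 (1 - x d) L = L T^-1.\<close>

lemma level_op_Tinv:
  "r ^ n * (level_op (\<lambda>i. x * s i) f n - x * level_op (\<lambda>i. x * s i) (qshift s f) n) =
    level_op (\<lambda>i. x * s i) (\<lambda>n. r ^ n * f n) n"
  using level_op_T[of n x s "\<lambda>n. r ^ n * f n"] by (metis (no_types, lifting) ext rq_pow(3,4))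

lemma band_op_level_op:
  "band_op x y z p K s (level_op (\<lambda>i. x * s i) (level_op (\<lambda>i. y * s i) f)) n =
   level_op (\<lambda>i. x * s i) (level_op (\<lambda>i. y * s i) (band_conj x y z p K s f)) n"
proof -
  let ?X = "level_op (\<lambda>i. x * s i)" and ?Y = "level_op (\<lambda>i. y * s i)"
  have shX: "qshift s (?X g) = ?X (qshift s g)" for g by (rule ext) (rule level_op_qshift)
  have shY: "qshift s (?Y g) = ?Y (qshift s g)" for g by (rule ext) (rule level_op_qshift)
  note lin = level_op_add level_op_diff level_op_cmult qshift_add qshift_diff qshift_cmult
  \<comment> \<open>The levels commute with d, so each cancels one of the factors 1 - x d and 1 - y
    d.\<close>
  have 1: "r ^ n * (?X (?Y f) n - (x + y) * qshift s (?X (?Y f)) n + x * y * qshift s (qshift s (?X (?Y f))) n)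
      = ?X (?Y (\<lambda>n. r ^ n * f n)) n"
  proof -
    have "?X (?Y f) n - (x + y) * qshift s (?X (?Y f)) n + x * y * qshift s (qshift s (?X (?Y f))) n
       = ?X (\<lambda>n. ?Y f n - y * ?Y (qshift s f) n) n - x * ?X (qshift s (\<lambda>n. ?Y f n - y * ?Y (qshift s f) n)) n"
      by (simp add: shX shY lin algebra_simps)
    then show ?thesis by (simp add: level_op_Tinv)
  qed
  \<comment> \<open>Moving T to the right past both levels creates these two factors again.\<close>
  have 2: "q ^ n * ?X (?Y f) n = ?X (?Y (\<lambda>n. q ^ n * f n - (x + y) * qshift s (\<lambda>n. q ^ n * f n) n
      + x * y * qshift s (qshift s (\<lambda>n. q ^ n * f n)) n)) n"
    unfolding level_op_T by (simp add: level_op_T shX shY lin algebra_simps)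
  show ?thesis
    unfolding band_op_def 1 2 unfolding band_conj_def
    by (simp add: shX shY lin algebra_simps)
qed

text \<open>With d' = \<open>qshift s'\<close>, the first assumption says d' = l T d = l q d T.
  Hence T^-1 d' = l d and T^-1 d' d' = l^2 q d d T, and the other assumptions match the
  coefficients.\<close>

lemma band_conj_band_op:
  assumes "\<And>i. s' i = l * q ^ Suc i * s i"
    and "z = - (x' + y') * l" "p * (x + y) = - z' * l * q" "p * (x * y) = x' * y' * l\<^sup>2 * q"
  shows "band_conj x y z p K s f n = band_op x' y' z' p K s' f n"
proof -
  have 1: "p * (x + y) * qshift s (\<lambda>n. q ^ n * f n) n = - z' * qshift s' f n"
  proof (cases n)
    case (Suc m)
    have "p * (x + y) * qshift s (\<lambda>n. q ^ n * f n) n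
        = - z' * (l * q * q ^ m * s m * (1 - q ^ Suc m) * f m)"
      unfolding assms(3) by (simp add: Suc mult_ac)
    then show ?thesis by (simp add: Suc assms(1) mult_ac)
  qed simp
  have 2: "p * (x * y) * qshift s (qshift s (\<lambda>n. q ^ n * f n)) n = x' * y' * (r ^ n * qshift s' (qshift s' f) n)"
  proof -
    consider "n = 0" | "n = Suc 0" | m where "n = Suc (Suc m)" by (metis not0_implies_Suc)
    then show ?thesis
    proof cases
      case 3
      have "r ^ n * qshift s' (qshift s' f) n = l\<^sup>2 * (r ^ n * q ^ n) * q * (q ^ m * qshift s (qshift s f) n)"
        by (simp add: 3 assms(1) power2_eq_square mult_ac)
      then show ?thesis
        unfolding assms(4) rq_pow by (simp add: 3 mult_ac)
    qed simp_all
  qed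
  have 3: "r ^ n * qshift s' f n = l * qshift s f n"
  proof (cases n)
    case (Suc m)
    have "r ^ n * qshift s' f n = (r ^ n * q ^ n) * (l * qshift s f n)"
      by (simp only: Suc qshift_Suc assms(1) mult_ac)
    then show ?thesis by (simp add: rq_pow)
  qed simp
  have "band_conj x y z p K s f n = r ^ n * f n - K * f n + p * (q ^ n * f n)
      - p * (x + y) * qshift s (\<lambda>n. q ^ n * f n) n
      + p * (x * y) * qshift s (qshift s (\<lambda>n. q ^ n * f n)) n - (x' + y') * (l * qshift s f n)"
    by (simp add: band_conj_def assms(2) algebra_simps)
  also have "\<dots> = band_op x' y' z' p K s' f n"
    unfolding 1 2 3[symmetric] band_op_def by (simp only: ring_distribs mult_ac) simp
  finally show ?thesis .
qed

end

end

section \<open>Paths with bounded east steps\<close>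

text \<open>\<open>SE\<close> for an arbitrary end point, since removing the last step of a path
  moves its end point.\<close>

definition paths_to :: "nat \<Rightarrow> nat \<times> real \<Rightarrow> (nat \<Rightarrow> nat \<times> real) set" where
  "paths_to k v = {p. p 0 = v \<and>
     (\<forall>m. south_step (p (Suc m)) (p m) \<or> east_step (p (Suc m)) (p m)) \<and>
     ((\<lambda>m. fst (p m)) \<longlonglongrightarrow> k) \<and> filterlim (\<lambda>m. snd (p m)) at_top sequentially}"

text \<open>Backwards along a path heights never decrease, so from height \<open>T\<close> on these
  paths are vertical.\<close>

definition low_paths :: "nat \<Rightarrow> nat \<Rightarrow> nat \<times> real \<Rightarrow> (nat \<Rightarrow> nat \<times> real) set" where
  "low_paths T k v =
     {p \<in> paths_to k v. \<forall>m. east_step (p (Suc m)) (p m) \<longrightarrow> snd (p m) < real T}"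

lemma south_step_iff:
  assumes "j \<le> i"
  shows "south_step u (lhv t i j) \<longleftrightarrow> u = lhv t i (Suc j)"
  using assms lhv_inj[of t i j] unfolding south_step_def by (metis Suc_eq_plus1)

lemma south_stepD:
  "south_step u v \<Longrightarrow> u = (fst v, snd v + 1 / real (Suc (fst v)))"
  by (auto simp: south_step_def lhv_def add_divide_distrib)

lemma east_step_iff:
  assumes "j \<le> i"
  shows "east_step u (lhv t i j) \<longleftrightarrow> j < i \<and> u = lhv t (i - 1) j"
proof
  assume "east_step u (lhv t i j)"
  then obtain t' i' j' where "j' \<le> i'" "u = lhv t' i' j'" "lhv t i j = lhv t' (i' + 1) j'"
    unfolding east_step_def by blast
  then show "j < i \<and> u = lhv t (i - 1) j"
    using lhv_inj[of t i j t' "i' + 1" j'] assms by auto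
next
  assume *: "j < i \<and> u = lhv t (i - 1) j"
  then have "i - 1 + 1 = i" "j \<le> i - 1" by auto
  then show "east_step u (lhv t i j)"
    unfolding east_step_def using * by metis
qed

lemma east_step_fst: "east_step u v \<Longrightarrow> fst v = Suc (fst u)"
  by (auto simp: east_step_def lhv_def)

text \<open>The columns converge in a discrete space, hence are eventually constant, while every
  east step changes the column.\<close>

lemma finite_east_steps_to:
  assumes "p \<in> paths_to k v"
  shows "finite {m. east_step (p (Suc m)) (p m)}"
proof -
  have "eventually (\<lambda>m. fst (p m) = k) sequentially"
    using assms by (simp add: paths_to_def tendsto_discrete)
  then obtain M where M: "\<And>m. m \<ge> M \<Longrightarrow> fst (p m) = k"
    by (auto simp: eventually_sequentially)
  have "{m. east_step (p (Suc m)) (p m)} \<subseteq> {..<M}"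
  proof
    fix m assume "m \<in> {m. east_step (p (Suc m)) (p m)}"
    then have "fst (p m) = Suc (fst (p (Suc m)))"
      using east_step_fst by blast
    then show "m \<in> {..<M}"
      using M[of m] M[of "Suc m"] by (cases "m < M") auto
  qed
  then show ?thesis by (rule finite_subset) simp
qed

lemma paths_to_Suc:
  "p \<in> paths_to k v \<longleftrightarrow> p 0 = v \<and> (south_step (p (Suc 0)) v \<or> east_step (p (Suc 0)) v) \<and>
     (\<lambda>m. p (Suc m)) \<in> paths_to k (p (Suc 0))"
proof -
  have "(\<forall>m. P m) \<longleftrightarrow> P 0 \<and> (\<forall>m. P (Suc m))" for P :: "nat \<Rightarrow> bool"
    by (metis not0_implies_Suc)
  note all = this[of "\<lambda>m. south_step (p (Suc m)) (p m) \<or> east_step (p (Suc m)) (p m)"]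
  show ?thesis
    unfolding paths_to_def mem_Collect_eq all
      filterlim_sequentially_Suc[of "\<lambda>m. fst (p m)"]
      filterlim_sequentially_Suc[of "\<lambda>m. snd (p m)"]
    by auto
qed

lemma low_paths_Suc:
  "p \<in> low_paths T k v \<longleftrightarrow> p 0 = v \<and>
     (south_step (p (Suc 0)) v \<or> east_step (p (Suc 0)) v) \<and>
     (east_step (p (Suc 0)) v \<longrightarrow> snd v < real T) \<and>
     (\<lambda>m. p (Suc m)) \<in> low_paths T k (p (Suc 0))"
proof -
  have "(\<forall>m. P m) \<longleftrightarrow> P 0 \<and> (\<forall>m. P (Suc m))" for P :: "nat \<Rightarrow> bool"
    by (metis not0_implies_Suc)
  note all = this[of "\<lambda>m. east_step (p (Suc m)) (p m) \<longrightarrow> snd (p m) < real T"]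
  show ?thesis
    unfolding low_paths_def mem_Collect_eq all paths_to_Suc[of p] by auto
qed

text \<open>Classification by the last step: \<open>case_nat\<close> puts the end point in front of
  a path to one of its predecessors. The bound \<open>t < T\<close> makes the east step
  admissible.\<close>

lemma low_paths_step:
  assumes "j \<le> i" "t < T"
  shows "low_paths T k (lhv t i j) =
    case_nat (lhv t i j) ` low_paths T k (lhv t i (Suc j)) \<union>
    (if j < i then case_nat (lhv t i j) ` low_paths T k (lhv t (i - 1) j) else {})"
    (is "?L = ?R")
proof -
  have snd: "snd (lhv t i j) < real T"
  proof -
    have "real j / real (i + 1) < 1" using assms by simp
    moreover have "real t + 1 \<le> real T" using assms by simp
    ultimately show ?thesis unfolding lhv_def snd_conv by linarith
  qed
  have 0: "p 0 = v" if "p \<in> low_paths T k v" for p v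
    using that by (simp add: low_paths_def paths_to_def)
  have eq: "p = case_nat (lhv t i j) (\<lambda>m. p (Suc m))" if "p 0 = lhv t i j" for p
    using that by (auto split: nat.split)
  show ?thesis
  proof (rule set_eqI)
    fix p
    show "p \<in> ?L \<longleftrightarrow> p \<in> ?R"
    proof
      assume "p \<in> ?L"
      then have "p 0 = lhv t i j"
        "p (Suc 0) = lhv t i (Suc j) \<or> (j < i \<and> p (Suc 0) = lhv t (i - 1) j)"
        "(\<lambda>m. p (Suc m)) \<in> low_paths T k (p (Suc 0))"
        unfolding low_paths_Suc[of p] south_step_iff[OF assms(1)] east_step_iff[OF assms(1)]
        by auto
      then show "p \<in> ?R" using eq[of p] by auto
    next
      assume "p \<in> ?R"
      then consider p' where "p = case_nat (lhv t i j) p'" "p' \<in> low_paths T k (lhv t i (Suc j))"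
        | p' where "j < i" "p = case_nat (lhv t i j) p'" "p' \<in> low_paths T k (lhv t (i - 1) j)"
        by (auto split: if_splits)
      then show "p \<in> ?L"
        unfolding low_paths_Suc[of p] south_step_iff[OF assms(1)] east_step_iff[OF assms(1)]
        by cases (auto simp: 0 snd)
    qed
  qed
qed

lemma path_weight_case_nat:
  assumes "p \<in> paths_to k u"
  shows "path_weight w (case_nat v p) =
    (if east_step u v then east_weight w u v else 1) * path_weight w p"
proof -
  let ?E = "{m. east_step (p (Suc m)) (p m)}"
  let ?c = "case_nat v p"
  have p0: "p 0 = u" using assms by (simp add: paths_to_def)
  have set: "{m. east_step (?c (Suc m)) (?c m)} = (if east_step u v then {0} else {}) \<union> Suc ` ?E"
  proof (rule set_eqI)
    fix m
    show "m \<in> {m. east_step (?c (Suc m)) (?c m)} \<longleftrightarrow>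
      m \<in> (if east_step u v then {0} else {}) \<union> Suc ` ?E"
      by (cases m) (auto simp: p0)
  qed
  have fin: "finite (Suc ` ?E)"
    using finite_east_steps_to[OF assms] by simp
  have "(\<Prod>m\<in>Suc ` ?E. east_weight w (?c (Suc m)) (?c m)) = path_weight w p"
    unfolding path_weight_def by (subst prod.reindex) (simp_all add: o_def)
  then show ?thesis
    unfolding path_weight_def[of w ?c] set using fin p0
    by (simp add: insert_absorb)
qed

lemma inj_case_nat: "inj_on (case_nat v) A"
proof (rule inj_onI)
  fix p p' :: "nat \<Rightarrow> 'a"
  assume eq: "case_nat v p = case_nat v p'"
  show "p = p'"
  proof
    fix n show "p n = p' n" using fun_cong[OF eq, of "Suc n"] by simp
  qed
qed

definition low_sum :: "(nat \<Rightarrow> nat \<Rightarrow> nat \<Rightarrow> 'a::comm_ring_1) \<Rightarrow> nat \<Rightarrow> nat \<Rightarrow> nat \<times> real \<Rightarrow> 'a" where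
  "low_sum w T k v = (\<Sum>p\<in>low_paths T k v. path_weight w p)"

lemma low_step:
  assumes "j \<le> i" "t < T"
    and "finite (low_paths T k (lhv t i (Suc j)))"
    and "j < i \<Longrightarrow> finite (low_paths T k (lhv t (i - 1) j))"
  shows "finite (low_paths T k (lhv t i j))"
    and "low_sum w T k (lhv t i j) = low_sum w T k (lhv t i (Suc j)) +
      (if j < i then w t (i - 1) j * low_sum w T k (lhv t (i - 1) j) else 0)"
proof -
  let ?c = "case_nat (lhv t i j)"
  let ?S = "low_paths T k (lhv t i (Suc j))" and ?E = "low_paths T k (lhv t (i - 1) j)"
  show "finite (low_paths T k (lhv t i j))"
    using assms unfolding low_paths_step[OF assms(1,2)] by auto
  have in_paths: "p \<in> paths_to k v \<and> p 0 = v" if "p \<in> low_paths T k v" for p v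
    using that by (simp add: low_paths_def paths_to_def)
  have ne: "\<not> east_step (lhv t i (Suc j)) (lhv t i j)"
    using east_step_fst by (force simp: lhv_def)
  have "path_weight w (?c p) = path_weight w p" if "p \<in> ?S" for p
    using path_weight_case_nat[OF conjunct1[OF in_paths[OF that]], of w "lhv t i j"] ne by simp
  then have S: "(\<Sum>p\<in>?c ` ?S. path_weight w p) = low_sum w T k (lhv t i (Suc j))"
    unfolding low_sum_def by (subst sum.reindex[OF inj_case_nat]) simp
  have E: "(\<Sum>p\<in>?c ` ?E. path_weight w p) = w t (i - 1) j * low_sum w T k (lhv t (i - 1) j)"
    if "j < i"
  proof -
    have e: "east_step (lhv t (i - 1) j) (lhv t i j)"
      using assms(1) that by (simp add: east_step_iff)
    have "east_weight w (lhv t (i - 1) j) (lhv t i j) = w t (i - 1) j"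
      using east_weight_lhv[of j "i - 1" w t] that by simp
    then have "path_weight w (?c p) = w t (i - 1) j * path_weight w p" if "p \<in> ?E" for p
      using path_weight_case_nat[OF conjunct1[OF in_paths[OF that]], of w "lhv t i j"] e by simp
    then show ?thesis
      unfolding low_sum_def sum_distrib_left by (subst sum.reindex[OF inj_case_nat]) simp
  qed
  \<comment> \<open>The vertices preceding the end point lie in different columns.\<close>
  have disj: "?c ` ?S \<inter> ?c ` ?E = {}" if "j < i"
  proof -
    have "lhv t i (Suc j) \<noteq> lhv t (i - 1) j" using that by (auto simp: lhv_def)
    then have "?S \<inter> ?E = {}"
      using in_paths by (metis disjoint_iff)
    then show ?thesis
      by (simp add: inj_case_nat flip: image_Int)
  qed
  show "low_sum w T k (lhv t i j) = low_sum w T k (lhv t i (Suc j)) +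
      (if j < i then w t (i - 1) j * low_sum w T k (lhv t (i - 1) j) else 0)"
  proof (cases "j < i")
    case True
    then show ?thesis
      using S E disj assms(3,4) unfolding low_sum_def[of w T k "lhv t i j"] low_paths_step[OF assms(1,2)]
      by (simp add: sum.union_disjoint)
  next
    case False
    then show ?thesis
      using S unfolding low_sum_def[of w T k "lhv t i j"] low_paths_step[OF assms(1,2)] by simp
  qed
qed

text \<open>Lets the second index exceed \<open>i\<close>: the points \<open>lhv t i m\<close>, for
  all \<open>m\<close>, form a vertical ray.\<close>

lemma lhv_shift: "lhv t i (m + (i + 1) * a) = lhv (t + a) i m"
  by (simp add: lhv_def field_simps)

lemma south_step_lhv: "south_step (lhv t i (Suc m)) (lhv t i m)"
proof -
  define a where "a = m div (i + 1)"
  define b where "b = m mod (i + 1)"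
  have m: "m = b + (i + 1) * a" by (simp only: a_def b_def mod_mult_div_eq)
  have b: "b \<le> i" by (simp add: b_def flip: less_Suc_eq_le)
  have "lhv t i m = lhv (t + a) i b" "lhv t i (Suc m) = lhv (t + a) i (b + 1)"
    using lhv_shift[of t i b a] lhv_shift[of t i "b + 1" a] m by simp_all
  then show ?thesis using b unfolding south_step_def by blast
qed

text \<open>From height \<open>T\<close> on no east step is left, so the only candidate is the ray
  \<open>lhv T i\<close>, read as a function of its last argument; its column must be the limit
  \<open>k\<close>.\<close>

lemma low_paths_top:
  "low_paths T k (lhv T i 0) = (if i = k then {lhv T k} else {})"
proof -
  have vert: "p = lhv T i" if p: "p \<in> low_paths T k (lhv T i 0)" for p
  proof
    fix m
    show "p m = lhv T i m"
    proof (induction m)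
      case 0
      then show ?case using p by (simp add: low_paths_def paths_to_def)
    next
      case (Suc m)
      have "real T \<le> snd (p m)"
        by (simp add: Suc lhv_def)
      then have "\<not> east_step (p (Suc m)) (p m)"
        using p by (fastforce simp: low_paths_def)
      then have "south_step (p (Suc m)) (p m)"
        using p by (auto simp: low_paths_def paths_to_def)
      from south_stepD[OF this] Suc show ?case
        by (simp add: lhv_def add_divide_distrib)
    qed
  qed
  have fst: "fst (lhv T i m) = i" for i m by (simp add: lhv_def)
  have in_iff: "lhv T i \<in> low_paths T k (lhv T i 0) \<longleftrightarrow> i = k"
  proof -
    have 1: "\<not> east_step (lhv T i (Suc m)) (lhv T i m)" for m
      using east_step_fst fst by (metis n_not_Suc_n)
    have "filterlim (\<lambda>m. real T + real m * (1 / real (i + 1))) at_top sequentially"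
      by (intro filterlim_tendsto_add_at_top[OF tendsto_const]
          filterlim_at_top_mult_tendsto_pos[OF tendsto_const] filterlim_real_sequentially) simp
    then have 2: "filterlim (\<lambda>m. snd (lhv T i m)) at_top sequentially"
      by (simp add: lhv_def)
    have 3: "(\<lambda>m::nat. i) \<longlonglongrightarrow> k \<longleftrightarrow> i = k"
      by (simp add: tendsto_const_iff)
    show ?thesis
      unfolding low_paths_def paths_to_def using 1 2 3 by (auto simp: fst south_step_lhv)
  qed
  show ?thesis using vert in_iff by auto
qed

lemma low_sum_top: "low_sum w T k (lhv T i 0) = (if i = k then 1 else 0)"
proof -
  have "\<not> east_step (lhv T k (Suc m)) (lhv T k m)" for m
    using east_step_fst[of "lhv T k (Suc m)" "lhv T k m"] by (auto simp: lhv_def)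
  then show ?thesis
    by (simp add: low_sum_def low_paths_top path_weight_def)
qed

text \<open>
  The sum over the paths that end at \<open>lhv t (j + d) j\<close>, where \<open>u\<close> gives the weights on level \<open>t\<close>, the
  index \<open>j + l\<close> is the column in which the path meets height \<open>t + 1\<close>, and \<open>g\<close> collects the
  contributions from above.
\<close>

definition level_sum where
  "level_sum q u g d j =
    (\<Sum>l\<le>d. (\<Prod>x\<in>{j + l..<j + d}. u x) * q ^ (j * (d - l)) * qbin q d l * g (j + l))"

text \<open>The two summands correspond to a south or an east step as last step into
  \<open>lhv t (j + Suc d) j\<close>; the q-Pascal rule matches this recursion.\<close>

lemma level_sum_Suc:
  "level_sum q u g (Suc d) j = level_sum q u g d (Suc j) + u (j + d) * q ^ j * level_sum q u g d j"
proof -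
  let ?P = "\<lambda>l. \<Prod>x\<in>{j + l..<j + Suc d}. u x"
  let ?s = "\<lambda>l. ?P l * q ^ (j * (Suc d - l)) * qbin q d l * g (j + l)"
  let ?r = "\<lambda>l. ?P (Suc l) * q ^ (Suc j * (d - l)) * qbin q d l * g (Suc j + l)"
  have pascal: "?P (Suc l) * q ^ (j * (Suc d - Suc l)) * qbin q (Suc d) (Suc l) * g (j + Suc l)
      = ?r l + ?s (Suc l)" for l
    by (simp only: qbin.simps diff_Suc_Suc mult_Suc power_add distrib_left distrib_right
        add_Suc_right add_Suc mult_ac)
  have "level_sum q u g (Suc d) j = ?s 0 + (\<Sum>l\<le>d. ?r l + ?s (Suc l))"
    unfolding level_sum_def sum.atMost_Suc_shift pascal by simp
  also have "\<dots> = (\<Sum>l\<le>d. ?r l) + (\<Sum>l\<le>Suc d. ?s l)"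
    unfolding sum.distrib sum.atMost_Suc_shift[of ?s] by (simp add: add_ac)
  also have "(\<Sum>l\<le>Suc d. ?s l) = (\<Sum>l\<le>d. ?s l)"
    by (simp add: qbin_eq_0)
  also have "\<dots> = u (j + d) * q ^ j * level_sum q u g d j"
    unfolding level_sum_def sum_distrib_left
    by (intro sum.cong) (simp_all add: Suc_diff_le power_add mult_ac)
  finally show ?thesis by (simp add: level_sum_def)
qed

lemma low_sum_level:
  assumes w: "\<And>i j. w t i j = w t i 0 * q ^ j" and "t < T"
    and fin: "\<And>i. finite (low_paths T k (lhv (Suc t) i 0))"
  shows "finite (low_paths T k (lhv t (j + d) j)) \<and>
    low_sum w T k (lhv t (j + d) j)
      = level_sum q (\<lambda>i. w t i 0) (\<lambda>i. low_sum w T k (lhv (Suc t) i 0)) d j"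
proof (induction d arbitrary: j)
  case 0
  \<comment> \<open>Into \<open>lhv t j j\<close> only a south step is possible, and it comes from
    height \<open>t + 1\<close>.\<close>
  have "lhv t j (Suc j) = lhv (Suc t) j 0"
    using lhv_wrap[of t j] by simp
  then show ?case
    using low_step[of j j t T k] fin[of j] \<open>t < T\<close> by (simp add: level_sum_def)
next
  case (Suc d)
  have fin': "finite (low_paths T k (lhv t (j + Suc d) (Suc j)))"
    "finite (low_paths T k (lhv t (j + Suc d - 1) j))"
    using Suc[of "Suc j"] Suc[of j] by simp_all
  show ?case
    using low_step(1)[OF _ \<open>t < T\<close> fin'] low_step(2)[OF _ \<open>t < T\<close> fin', of w] Suc[of "Suc j"] Suc[of j]
    by (simp add: level_sum_Suc flip: w[of "j + d" j])
qed

text \<open>Column \<open>k\<close> of the product of the matrices of the \<open>N\<close> levels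
  from \<open>t\<close> on.\<close>

fun level_iter where
  "level_iter q w k t 0 = (\<lambda>n. if n = k then 1 else 0)"
| "level_iter q w k t (Suc N) = level_op q (\<lambda>i. w t i 0) (level_iter q w k (Suc t) N)"

lemma low_sum_level_iter:
  assumes w: "\<And>t i j. w t i j = w t i 0 * q ^ j"
  shows "finite (low_paths (t + N) k (lhv t n 0)) \<and>
    low_sum w (t + N) k (lhv t n 0) = level_iter q w k t N n"
proof (induction N arbitrary: t n)
  case 0
  then show ?case by (simp add: low_sum_top low_paths_top)
next
  case (Suc N)
  have IH: "finite (low_paths (t + Suc N) k (lhv (Suc t) n 0))"
    "low_sum w (t + Suc N) k (lhv (Suc t) n 0) = level_iter q w k (Suc t) N n" for n
    using Suc[of "Suc t" n] by simp_all
  \<comment> \<open>For \<open>j = 0\<close> the powers of \<open>q\<close> in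
    \<open>level_sum\<close> disappear and it becomes \<open>level_op\<close>.\<close>
  show ?case
    using low_sum_level[of w t q "t + Suc N" k 0 n, OF w _ IH(1)] IH(2)
    by (simp add: level_sum_def level_op_def lessThan_atLeast0)
qed

section \<open>The eigenvalue equation for path sums\<close>

lemma dvd_level_op: "(\<And>n. d dvd f n) \<Longrightarrow> d dvd level_op q u f n"
  unfolding level_op_def by (intro dvd_sum dvd_mult)

lemma dvd_qshift: "(\<And>n. d dvd f n) \<Longrightarrow> d dvd qshift q s f n"
  by (cases n) auto

lemma dvd_qshift_weight: "(\<And>i. d dvd s i) \<Longrightarrow> d dvd qshift q s f n"
  by (cases n) (auto simp: mult.assoc)

lemma band_op_diff:
  "band_op q r x y z p K s (\<lambda>n. f n - g n) n = band_op q r x y z p K s f n - band_op q r x y z p K s g n"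
  by (simp add: band_op_def qshift_diff algebra_simps)

lemma dvd_band_op: "(\<And>n. d dvd f n) \<Longrightarrow> d dvd band_op q r x y z p K s f n"
  unfolding band_op_def by (intro dvd_add dvd_diff dvd_mult dvd_qshift)

text \<open>The level matrices are lower unitriangular.\<close>

lemma level_op_low:
  assumes "\<And>m. m < n \<Longrightarrow> f m = 0"
  shows "level_op q u f n = f n"
proof -
  have "level_op q u f n = (\<Sum>m\<in>{n}. (\<Prod>i\<in>{m..<n}. u i) * qbin q n m * f m)"
    unfolding level_op_def by (intro sum.mono_neutral_right) (use assms in auto)
  then show ?thesis by simp
qed

lemma level_iter_low: "n \<le> k \<Longrightarrow> level_iter q w k t N n = (if n = k then 1 else 0)"
proof (induction N arbitrary: t n)
  case (Suc N)
  show ?case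
    unfolding level_iter.simps by (subst level_op_low) (use Suc in auto)
qed simp

section \<open>Divisibility by powers of \<open>aa\<close> and truncation of the path sums\<close>

abbreviation (input) rr :: ser where "rr \<equiv> scal (inverse q0)"

lemma scal_mult: "scal (x * y) = scal x * scal y"
  by (simp add: scal_def)

lemma scal_1: "scal 1 = 1"
  by (simp add: scal_def)

lemma q0_neq_0: "q0 \<noteq> 0"
  by (simp add: q0_def Zero_fract_def eq_fract)

lemma rr_qq: "rr * qq = 1"
  by (simp add: qq_def q0_neq_0 scal_1 flip: scal_mult)

lemma coeff3_aa_power_mult:
  "coeff3 (aa ^ s * g) i j l = (if i < s then 0 else coeff3 g (i - s) j l)"
  by (simp add: coeff3_def aa_def fps_const_power fps_mult_left_const_nth fps_X_power_mult_nth)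

text \<open>Vanishing of all coefficients with a-exponent below \<open>s\<close> becomes a condition
  stable under sums and multiples.\<close>

lemma aa_power_dvd_iff: "aa ^ s dvd f \<longleftrightarrow> (\<forall>i j l. i < s \<longrightarrow> coeff3 f i j l = 0)"
proof
  assume "aa ^ s dvd f"
  then show "\<forall>i j l. i < s \<longrightarrow> coeff3 f i j l = 0"
    by (auto simp: coeff3_aa_power_mult elim!: dvdE)
next
  assume *: "\<forall>i j l. i < s \<longrightarrow> coeff3 f i j l = 0"
  define g :: ser where "g = Abs_fps (\<lambda>l. Abs_fps (\<lambda>j. fps_shift s (f $ l $ j)))"
  have "coeff3 f i j l = coeff3 (aa ^ s * g) i j l" for i j l
    unfolding coeff3_aa_power_mult using * by (simp add: coeff3_def g_def)
  then have "f = aa ^ s * g"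
    by (simp add: coeff3_def fps_eq_iff)
  then show "aa ^ s dvd f" by simp
qed

text \<open>The a-adic filtration is separated; limits are taken through this fact.\<close>

lemma eq_if_aa_powers_dvd:
  assumes "\<And>s. aa ^ s dvd f - g"
  shows "f = g"
proof -
  have "coeff3 (f - g) i j l = 0" for i j l
    using assms[of "Suc i"] unfolding aa_power_dvd_iff by blast
  then show ?thesis by (simp add: coeff3_def fps_eq_iff)
qed

lemma wt_power: "wt t i j = wt t i 0 * qq ^ j"
  by (simp add: wt_def)

lemma aa_power_dvd_wt:
  assumes "4 * s \<le> t"
  shows "aa ^ s dvd wt t i j"
proof -
  have "s \<le> t div 4" using assms by linarith
  then have "aa ^ s dvd (aa * bb * qq ^ (2 * i + 2)) ^ (t div 4)"
    by (simp add: power_mult_distrib le_imp_power_dvd dvd_mult2)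
  then show ?thesis unfolding wt_def by (intro dvd_mult2)
qed

lemma SE_eq_paths_to: "SE k n = paths_to k (lhv 0 n 0)"
  by (simp add: SE_def paths_to_def lhv_def)

text \<open>Such a path has an east step on a level \<open>t\<close> with
  \<open>4 * s \<le> t\<close>, whose weight is divisible by \<open>aa ^ s\<close>.\<close>

lemma aa_power_dvd_path_weight:
  assumes "p \<in> paths_to k v" "p \<notin> low_paths (4 * s) k v"
  shows "aa ^ s dvd path_weight wt p"
proof -
  obtain m where m: "east_step (p (Suc m)) (p m)" "real (4 * s) \<le> snd (p m)"
    using assms by (auto simp: low_paths_def not_less)
  then obtain t i j where tij: "j \<le> i" "p (Suc m) = lhv t i j" "p m = lhv t (i + 1) j"
    by (auto simp: east_step_def)
  have "real j / real (i + 1 + 1) < 1"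
    using tij(1) by simp
  moreover have "real (4 * s) \<le> real t + real j / real (i + 1 + 1)"
    using m(2) by (simp only: tij(3) lhv_def snd_conv)
  ultimately have "real (4 * s) < real t + 1" by linarith
  then have "4 * s \<le> t" by linarith
  then have "aa ^ s dvd east_weight wt (p (Suc m)) (p m)"
    unfolding tij(2,3) east_weight_lhv[OF tij(1)] by (rule aa_power_dvd_wt)
  also have "\<dots> dvd path_weight wt p"
    unfolding path_weight_def using finite_east_steps_to[OF assms(1)] m(1)
    by (intro dvd_prodI) auto
  finally show ?thesis .
qed

lemma coeff3_sum: "coeff3 (sum f A) i j l = (\<Sum>x\<in>A. coeff3 (f x) i j l)"
  by (simp add: coeff3_def fps_sum_nth)

text \<open>Coefficients with a-exponent below \<open>s\<close> receive contributions only from the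
  finitely many paths truncated at height \<open>4 * s\<close>, whose sum is
  \<open>level_iter\<close>.\<close>

lemma
  shows formally_summable_path_weight: "formally_summable (path_weight wt) (SE k n)"
    and aa_power_dvd_h: "aa ^ s dvd h wt n k - level_iter qq wt k 0 (4 * s) n"
proof -
  let ?N = "\<lambda>i j l. {p \<in> SE k n. coeff3 (path_weight wt p) i j l \<noteq> 0}"
  let ?L = "\<lambda>s. low_paths (4 * s) k (lhv 0 n 0)"
  have sub: "?N i j l \<subseteq> ?L s" if "i < s" for i j l s
    using that aa_power_dvd_path_weight aa_power_dvd_iff unfolding SE_eq_paths_to by blast
  have low: "finite (?L s)" "low_sum wt (4 * s) k (lhv 0 n 0) = level_iter qq wt k 0 (4 * s) n" for s
    using low_sum_level_iter[of wt qq 0 "4 * s" k n, OF wt_power] unfolding add_0 by blast+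
  show "formally_summable (path_weight wt) (SE k n)"
    unfolding formally_summable_def by (intro allI finite_subset[OF sub[OF lessI] low(1)])
  have "coeff3 (h wt n k - level_iter qq wt k 0 (4 * s) n) i j l = 0" if "i < s" for i j l
  proof -
    have LSE: "?L s \<subseteq> SE k n" by (auto simp: SE_eq_paths_to low_paths_def)
    have "coeff3 (h wt n k) i j l = (\<Sum>p\<in>?N i j l. coeff3 (path_weight wt p) i j l)"
      by (simp add: h_def formal_sum_def coeff3_def)
    also have "\<dots> = (\<Sum>p\<in>?L s. coeff3 (path_weight wt p) i j l)"
      using sub[OF that] low(1)[of s] LSE by (intro sum.mono_neutral_left) auto
    also have "\<dots> = coeff3 (level_iter qq wt k 0 (4 * s) n) i j l"
      unfolding low(2)[symmetric] low_sum_def coeff3_sum ..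
    finally show ?thesis by (simp add: coeff3_def)
  qed
  then show "aa ^ s dvd h wt n k - level_iter qq wt k 0 (4 * s) n"
    by (simp add: aa_power_dvd_iff)
qed

lemma h_low: "n \<le> k \<Longrightarrow> h wt n k = (if n = k then 1 else 0)"
  using aa_power_dvd_h[of _ n k] by (intro eq_if_aa_powers_dvd) (simp only: level_iter_low)

text \<open>The operator M is the case \<open>s = 1\<close>; the case \<open>s = scale4 m\<close> is
  what M becomes after moving past the first \<open>4 * m\<close> levels.\<close>

abbreviation (input) jacobi_op :: "(nat \<Rightarrow> ser) \<Rightarrow> (nat \<Rightarrow> ser) \<Rightarrow> nat \<Rightarrow> ser" where
  "jacobi_op s \<equiv> band_op qq rr (cc * qq) (aa * qq) (aa * qq * (bb + cc)) (aa * bb * qq) (1 + aa * bb * qq) s"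

text \<open>Diagonal entry of M, equal to q^-n (1 - q^n) (1 - a b q^(n + 1)).\<close>

definition eigen :: "nat \<Rightarrow> ser" where
  "eigen n = rr ^ n - (1 + aa * bb * qq) + aa * bb * qq * qq ^ n"

definition scale4 :: "nat \<Rightarrow> nat \<Rightarrow> ser" where
  "scale4 m i = (aa * bb * qq ^ (2 * i + 2)) ^ m"

text \<open>Constants times shift weights, as \<open>band_op_level_op\<close> requires; the last two
  levels of a block use the shift weight of the operator reached after the first two.\<close>

lemma wt_levels:
  "wt (4 * m) i 0 = cc * qq * scale4 m i"
  "wt (Suc (4 * m)) i 0 = aa * qq * scale4 m i"
  "wt (Suc (Suc (4 * m))) i 0 = - (aa * cc * qq) * (qq ^ Suc i * scale4 m i)"
  "wt (Suc (Suc (Suc (4 * m)))) i 0 = - (aa * bb * qq) * (qq ^ Suc i * scale4 m i)"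
proof -
  have "(4 * m) mod 4 = 0" "Suc (4 * m) mod 4 = 1" "Suc (Suc (4 * m)) mod 4 = 2"
    "Suc (Suc (Suc (4 * m))) mod 4 = 3" "(4 * m) div 4 = m" "Suc (4 * m) div 4 = m"
    "Suc (Suc (4 * m)) div 4 = m" "Suc (Suc (Suc (4 * m))) div 4 = m"
    by presburger+
  then show "wt (4 * m) i 0 = cc * qq * scale4 m i"
    "wt (Suc (4 * m)) i 0 = aa * qq * scale4 m i"
    "wt (Suc (Suc (4 * m))) i 0 = - (aa * cc * qq) * (qq ^ Suc i * scale4 m i)"
    "wt (Suc (Suc (Suc (4 * m)))) i 0 = - (aa * bb * qq) * (qq ^ Suc i * scale4 m i)"
    by (simp_all add: wt_def scale4_def mult_ac)
qed

text \<open>Two levels, with \<open>l = 1\<close>, lead to the parameters in \<open>half\<close>;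
  the next two, with \<open>l = aa * bb\<close>, restore the original ones and turn
  \<open>scale4 m\<close> into \<open>scale4 (Suc m)\<close>.\<close>

lemma jacobi_op_four_levels:
  fixes m g
  defines "G \<equiv> \<lambda>f. level_op qq (\<lambda>i. wt (4 * m) i 0) (level_op qq (\<lambda>i. wt (Suc (4 * m)) i 0)
    (level_op qq (\<lambda>i. wt (Suc (Suc (4 * m))) i 0) (level_op qq (\<lambda>i. wt (Suc (Suc (Suc (4 * m)))) i 0) f)))"
  shows "jacobi_op (scale4 m) (G g) n = G (jacobi_op (scale4 (Suc m)) g) n"
proof -
  let ?s = "\<lambda>i. qq ^ Suc i * scale4 m i"
  have half: "band_conj qq rr (cc * qq) (aa * qq) (aa * qq * (bb + cc)) (aa * bb * qq) K (scale4 m) f n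
     = band_op qq rr (- (aa * cc * qq)) (- (aa * bb * qq)) (- (aa * bb * qq) * (aa + cc)) (aa * bb * qq) K ?s f n"
    for K f n
    by (rule band_conj_band_op[OF rr_qq, where l = 1]) (simp_all add: algebra_simps power2_eq_square)
  have full: "band_conj qq rr (- (aa * cc * qq)) (- (aa * bb * qq)) (- (aa * bb * qq) * (aa + cc)) (aa * bb * qq) K ?s f n
     = band_op qq rr (cc * qq) (aa * qq) (aa * qq * (bb + cc)) (aa * bb * qq) K (scale4 (Suc m)) f n"
    for K f n
    by (rule band_conj_band_op[OF rr_qq, where l = "aa * bb"])
      (simp_all add: scale4_def algebra_simps power2_eq_square mult_2 mult_2_right power_add)
  show ?thesis
    unfolding G_def wt_levels band_op_level_op[OF rr_qq] half full by simp
qed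

text \<open>For \<open>N = 0\<close> the unit column violates the eigenvalue equation only by the
  off-diagonal part, which contains \<open>scale4 m\<close> and so \<open>aa ^ m\<close>. The step
  moves the operator past four levels, raising \<open>m\<close> by one.\<close>

lemma aa_power_dvd_level_iter:
  "aa ^ (m + N) dvd jacobi_op (scale4 m) (level_iter qq wt k (4 * m) (4 * N)) n
     - eigen k * level_iter qq wt k (4 * m) (4 * N) n"
proof (induction N arbitrary: m n)
  case 0
  let ?d = "\<lambda>n. if n = k then 1 else 0 :: ser"
  have "aa ^ m dvd scale4 m i" for i
    by (simp add: scale4_def power_mult_distrib)
  note qshift = dvd_qshift_weight[OF this]
  have "jacobi_op (scale4 m) ?d n - eigen k * ?d n =
     rr ^ n * (cc * qq * (aa * qq) * qshift qq (scale4 m) (qshift qq (scale4 m) ?d) n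
       - (cc * qq + aa * qq) * qshift qq (scale4 m) ?d n)
       + aa * qq * (bb + cc) * qshift qq (scale4 m) ?d n"
    by (simp add: band_op_def eigen_def algebra_simps)
  also have "aa ^ m dvd \<dots>"
    by (intro dvd_add dvd_diff dvd_mult qshift)
  finally show ?case by simp
next
  case (Suc N)
  define g where "g = level_iter qq wt k (4 * Suc m) (4 * N)"
  define G where "G = (\<lambda>f. level_op qq (\<lambda>i. wt (4 * m) i 0) (level_op qq (\<lambda>i. wt (Suc (4 * m)) i 0)
    (level_op qq (\<lambda>i. wt (Suc (Suc (4 * m))) i 0) (level_op qq (\<lambda>i. wt (Suc (Suc (Suc (4 * m)))) i 0) f))))"
  have "4 * Suc N = Suc (Suc (Suc (Suc (4 * N))))" "4 * Suc m = Suc (Suc (Suc (Suc (4 * m))))"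
    by simp_all
  then have level_iter: "level_iter qq wt k (4 * m) (4 * Suc N) = G g"
    unfolding G_def g_def by (simp only: level_iter.simps)
  have "jacobi_op (scale4 m) (G g) n - eigen k * G g n
      = G (\<lambda>n. jacobi_op (scale4 (Suc m)) g n - eigen k * g n) n"
    unfolding G_def jacobi_op_four_levels by (simp add: level_op_diff level_op_cmult)
  moreover have "aa ^ (m + Suc N) dvd G (\<lambda>n. jacobi_op (scale4 (Suc m)) g n - eigen k * g n) n"
    unfolding G_def using Suc[of "Suc m"] by (intro dvd_level_op) (simp add: g_def)
  ultimately show ?case unfolding level_iter by simp
qed

text \<open>Modulo each power of \<open>aa\<close>, \<open>h\<close> agrees with a
  \<open>level_iter\<close> that satisfies the equation modulo that power.\<close>

lemma jacobi_op_h: "jacobi_op (\<lambda>_. 1) (\<lambda>n. h wt n k) n = eigen k * h wt n k"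
proof (rule eq_if_aa_powers_dvd)
  fix s
  let ?l = "level_iter qq wt k 0 (4 * s)"
  let ?e = "\<lambda>n. h wt n k - ?l n"
  have e: "aa ^ s dvd ?e n" for n by (rule aa_power_dvd_h)
  have "scale4 0 = (\<lambda>_. 1)" by (auto simp: scale4_def)
  then have l: "aa ^ s dvd jacobi_op (\<lambda>_. 1) ?l n - eigen k * ?l n"
    using aa_power_dvd_level_iter[of 0 s k n] by simp
  have "aa ^ s dvd jacobi_op (\<lambda>_. 1) ?e n - eigen k * ?e n + (jacobi_op (\<lambda>_. 1) ?l n - eigen k * ?l n)"
    by (intro dvd_add[OF dvd_diff[OF dvd_band_op[OF e] dvd_mult[OF e]] l])
  then show "aa ^ s dvd jacobi_op (\<lambda>_. 1) (\<lambda>n. h wt n k) n - eigen k * h wt n k"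
    unfolding band_op_diff by (simp add: algebra_simps)
qed

section \<open>The q-difference operator of the big q-Jacobi polynomials\<close>

abbreviation (input) cst :: "'a::comm_ring_1 \<Rightarrow> 'a poly" where "cst c \<equiv> [:c:]"
definition XX :: "ser poly" where "XX = [:0, 1:]"
abbreviation (input) xpoch :: "nat \<Rightarrow> ser poly" where "xpoch j \<equiv> qpoch XX [:qq:] j"

lemma cst_mult: "cst (x * y) = cst x * cst y"
  and cst_add: "cst (x + y) = cst x + cst y"
  and cst_diff: "cst (x - y) = cst x - cst y"
  and cst_minus: "cst (- x) = - cst x"
  and cst_1: "cst 1 = 1"
  by (simp_all add: one_pCons)

lemma cst_power: "cst (x ^ n) = cst x ^ n"
proof (induction n)
  case (Suc n)
  then show ?case by (simp only: power_Suc cst_mult)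
qed (simp add: one_pCons)

lemmas cst_hom = cst_mult cst_add cst_diff cst_minus cst_1 cst_power

lemma smult_cst: "smult c p = cst c * p"
  by simp

text \<open>
  The q-difference equation of the big q-Jacobi polynomials reads \<open>qdiff p\<^sub>n = x\<^sup>2 (eigen n) p\<^sub>n\<close>.
  On Pochhammer products it is two-banded, on monomials it is \<open>x\<^sup>2\<close> times the operator of the paths.
\<close>

definition qdiff :: "ser poly \<Rightarrow> ser poly" where
  "qdiff y =
     cst (aa * qq) * (XX - 1) * (cst bb * XX - cst cc) * (pcompose y [:0, qq:] - y)
     + (XX - cst (aa * qq)) * (XX - cst (cc * qq)) * (pcompose y [:0, rr:] - y)"

lemma qdiff_cst: "qdiff (cst c * y) = cst c * qdiff y"
  unfolding qdiff_def pcompose_mult pcompose_const by (simp only: algebra_simps mult_1_left mult_1_right)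

lemma qdiff_add: "qdiff (y + z) = qdiff y + qdiff z"
  unfolding qdiff_def pcompose_add by (simp only: algebra_simps mult_1_left mult_1_right)

lemma qdiff_diff: "qdiff (y - z) = qdiff y - qdiff z"
  unfolding qdiff_def pcompose_diff by (simp only: algebra_simps mult_1_left mult_1_right)

lemma qdiff_sum: "qdiff (sum f A) = (\<Sum>x\<in>A. qdiff (f x))"
proof (induction A rule: infinite_finite_induct)
  case (insert x A)
  then show ?case by (simp add: qdiff_add)
qed (simp_all add: qdiff_def)

lemma qpoch_Suc: "qpoch z q (Suc k) = qpoch z q k * (1 - z * q ^ k)"
  by (simp add: qpoch_def)

lemma qpoch_Suc_left: "qpoch z q (Suc k) = (1 - z) * qpoch (z * q) q k"
  unfolding qpoch_def by (subst prod.lessThan_Suc_shift) (simp add: mult.assoc)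

lemma pcompose_XX: "pcompose XX p = p"
  by (simp add: XX_def pcompose_pCons)

lemma pcompose_XX_right: "pcompose p XX = p"
  by (simp add: XX_def pcompose_idR)

lemma pcompose_power: "pcompose (p ^ n) s = pcompose p s ^ n" for p s :: "ser poly"
  by (induction n) (simp_all add: pcompose_mult pcompose_1)

lemma pcompose_qpoch:
  "pcompose (qpoch p (cst t) k) s = qpoch (pcompose p s) (cst t) k" for p s :: "ser poly"
  by (induction k)
    (simp_all add: qpoch_def pcompose_mult pcompose_1 pcompose_diff pcompose_power)

text \<open>Coefficient of (x;q)_(j-1) in x^-2 times \<open>qdiff\<close> of (x;q)_j.\<close>

definition lower :: "nat \<Rightarrow> ser" where
  "lower j = - ((1 - qq ^ j) * rr ^ j * (1 - aa * qq ^ j) * (1 - cc * qq ^ j))"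

lemma rr_qq_power: "rr ^ n * qq ^ n = 1"
  by (rule rq_pow(1)[OF rr_qq])

text \<open>For \<open>U = q\<^sup>m\<close>, \<open>V = q\<^sup>-\<^sup>m\<^sup>-\<^sup>1\<close>, \<open>R = q\<^sup>-\<^sup>1\<close>.\<close>

lemma qdiff_xpoch_identity:
  fixes A B C Q R U V X P :: "'a::comm_ring_1"
  assumes "V * (U * Q) = 1" "R = V * U"
  shows "- (A * Q * (B * X - C) * X * (1 - Q * U) * (P * (1 - X * U)))
      + (X - A * Q) * (X - C * Q) * (P * X * (U - R))
    = X\<^sup>2 * ((V - (1 + A * B * Q) + A * B * Q * (U * Q)) * (P * (1 - X * U))
       + - ((1 - U * Q) * V * (1 - A * (U * Q)) * (1 - C * (U * Q))) * P)"
proof -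
  \<comment> \<open>What remains to be compared once the common factor
    \<open>X * V * (1 - U * Q) * P\<close> is taken out.\<close>
  have E: "- (A * Q * (B * X - C) * (U * Q) * (1 - X * U)) - (X - A * Q) * (X - C * Q) * U
     = X * ((1 - A * B * Q * (U * Q)) * (1 - X * U) - (1 - A * (U * Q)) * (1 - C * (U * Q)))"
    by (simp add: algebra_simps)
  have 1: "U - R = - (V * U * (1 - U * Q))"
    using assms by (simp add: right_diff_distrib mult.assoc mult.left_commute[of V U])
  have 2: "V - (1 + A * B * Q) + A * B * Q * (U * Q) = V * (1 - U * Q) * (1 - A * B * Q * (U * Q))"
  proof -
    have "V * (1 - U * Q) = V - 1" using assms(1) by (simp add: right_diff_distrib)
    moreover have "V * (A * B * Q * (U * Q)) = A * B * Q"
      using assms(1) by (metis mult.left_commute mult.right_neutral)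
    ultimately show ?thesis by (simp add: right_diff_distrib left_diff_distrib)
  qed
  \<comment> \<open>Inserting \<open>V * (U * Q) = 1\<close> gives both summands the factor
    \<open>V\<close>.\<close>
  have 3: "A * Q * (B * X - C) * X * (1 - Q * U) * (P * (1 - X * U))
     = (V * (U * Q)) * (A * Q * (B * X - C) * X * (1 - Q * U) * (P * (1 - X * U)))"
    using assms(1) by simp
  have "- (A * Q * (B * X - C) * X * (1 - Q * U) * (P * (1 - X * U)))
      + (X - A * Q) * (X - C * Q) * (P * X * (U - R))
     = X * V * (1 - U * Q) * P *
      (- (A * Q * (B * X - C) * (U * Q) * (1 - X * U)) - (X - A * Q) * (X - C * Q) * U)"
    by (subst 3, subst 1) (simp only: mult_ac right_diff_distrib mult_minus_left mult_minus_right, simp)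
  also have "\<dots> = X\<^sup>2 * ((V - (1 + A * B * Q) + A * B * Q * (U * Q)) * (P * (1 - X * U))
       + - ((1 - U * Q) * V * (1 - A * (U * Q)) * (1 - C * (U * Q))) * P)"
    unfolding E 2 power2_eq_square by (simp add: algebra_simps)
  finally show ?thesis .
qed

text \<open>Each dilation changes only one factor of (x;q)_(m+1), up to a shift, so the differences
  \<open>d1\<close> and \<open>d2\<close> are single products; \<open>?z\<close> is
  (qx;q)_m.\<close>

lemma qdiff_xpoch_Suc:
  "qdiff (xpoch (Suc m)) = XX\<^sup>2 * (cst (eigen (Suc m)) * xpoch (Suc m) + cst (lower (Suc m)) * xpoch m)"
proof -
  let ?P = "xpoch m" and ?z = "pcompose (xpoch m) [:0, qq:]"
  let ?U = "cst qq ^ m" and ?V = "cst rr ^ Suc m"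
  have z: "?z = qpoch (XX * cst qq) (cst qq) m"
  proof -
    have "[:0, qq:] = XX * cst qq" by (simp add: XX_def)
    then show ?thesis by (simp only: pcompose_qpoch pcompose_XX)
  qed
  have y1: "xpoch (Suc m) = (1 - XX) * ?z"
    unfolding z by (rule qpoch_Suc_left)
  have y2: "xpoch (Suc m) = ?P * (1 - XX * ?U)"
    by (rule qpoch_Suc)
  have yq: "pcompose (xpoch (Suc m)) [:0, qq:] = ?z * (1 - XX * (cst qq * ?U))"
  proof -
    have "pcompose XX [:0, qq:] = XX * cst qq" unfolding pcompose_XX by (simp add: XX_def)
    then show ?thesis
      unfolding y2
      by (simp only: pcompose_mult pcompose_diff pcompose_1 pcompose_power pcompose_const mult.assoc)
  qed
  have undo: "pcompose ?z [:0, rr:] = ?P"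
  proof -
    have "pcompose [:0, qq:] [:0, rr:] = XX"
      using rr_qq by (simp add: XX_def pcompose_pCons mult.commute)
    then show ?thesis by (simp add: pcompose_XX_right flip: pcompose_assoc)
  qed
  have yr: "pcompose (xpoch (Suc m)) [:0, rr:] = (1 - cst rr * XX) * ?P"
    unfolding y1 pcompose_mult undo by (simp add: pcompose_diff pcompose_1 pcompose_XX) (simp add: XX_def)
  have d1: "pcompose (xpoch (Suc m)) [:0, qq:] - xpoch (Suc m) = ?z * XX * (1 - cst qq * ?U)"
    unfolding yq unfolding y1 by (simp only: algebra_simps mult_1_left mult_1_right)
  have d2: "pcompose (xpoch (Suc m)) [:0, rr:] - xpoch (Suc m) = ?P * XX * (?U - cst rr)"
    unfolding yr unfolding y2 by (simp only: algebra_simps mult_1_left mult_1_right)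
  have VU: "?V * (?U * cst qq) = 1" "cst rr = ?V * ?U"
  proof -
    have "cst (rr ^ Suc m * qq ^ Suc m) = 1" "cst (rr * (rr ^ m * qq ^ m)) = cst rr"
      unfolding rr_qq_power by (simp_all add: one_pCons)
    then show "?V * (?U * cst qq) = 1" "cst rr = ?V * ?U"
      unfolding cst_hom by (simp_all only: power_Suc mult_ac)
  qed
  have "qdiff (xpoch (Suc m)) =
     - (cst aa * cst qq * (cst bb * XX - cst cc) * XX * (1 - cst qq * ?U) * xpoch (Suc m))
      + (XX - cst aa * cst qq) * (XX - cst cc * cst qq) * (?P * XX * (?U - cst rr))"
  proof -
    have "XX - 1 = - (1 - XX)" by simp
    then show ?thesis
      unfolding qdiff_def d1 d2 unfolding y1 cst_mult
      by (simp only: mult_minus_left mult_minus_right mult_ac)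
  qed
  also have "\<dots> = XX\<^sup>2 * (cst (eigen (Suc m)) * xpoch (Suc m) + cst (lower (Suc m)) * xpoch m)"
    unfolding y2 qdiff_xpoch_identity[OF VU] eigen_def lower_def cst_hom
    by (simp only: power_Suc2 mult.assoc)
  finally show ?thesis .
qed

lemma eigen_0: "eigen 0 = 0"
  by (simp add: eigen_def)

lemma lower_0: "lower 0 = 0"
  by (simp add: lower_def)

lemma qdiff_1: "qdiff 1 = 0"
  by (simp add: qdiff_def pcompose_1)

text \<open>At \<open>j = 0\<close> both coefficients vanish, which covers the truncated index
  \<open>j - 1\<close>.\<close>

lemma qdiff_xpoch:
  "qdiff (xpoch j) = XX\<^sup>2 * (cst (eigen j) * xpoch j + cst (lower j) * xpoch (j - 1))"
proof (cases j)
  case 0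
  then show ?thesis by (simp add: qpoch_def qdiff_1 eigen_0 lower_0)
next
  case (Suc m)
  then show ?thesis using qdiff_xpoch_Suc[of m] by simp
qed

text \<open>M with constant polynomials as entries, acting on sequences of polynomials such as the
  monomials.\<close>

abbreviation (input) jacobi_poly_op :: "(nat \<Rightarrow> ser poly) \<Rightarrow> nat \<Rightarrow> ser poly" where
  "jacobi_poly_op \<equiv> band_op (cst qq) (cst rr) (cst (cc * qq)) (cst (aa * qq)) (cst (aa * qq * (bb + cc)))
     (cst (aa * bb * qq)) (cst (1 + aa * bb * qq)) (\<lambda>_. 1)"

text \<open>
  For \<open>U = q\<^sup>n\<close>, \<open>V = q\<^sup>-\<^sup>n\<close>, \<open>R = q\<^sup>-\<^sup>1\<close> and \<open>P, P', P''\<close> the powers \<open>n, n - 1, n - 2\<close> of \<open>X\<close>. The last two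
  assumptions also hold where the subtraction in the exponent is truncated.
\<close>

lemma qdiff_power_identity:
  fixes A B C Q R U V X P P' P'' :: "'a::comm_ring_1"
  assumes "V * U = 1" "R * Q = 1" "(1 - U) * (P - X * P') = 0"
    "(1 - U) * (1 - U * R) * (P - X\<^sup>2 * P'') = 0"
  shows "A * Q * (X - 1) * (B * X - C) * (U * P - P) + (X - A * Q) * (X - C * Q) * (V * P - P)
    = X\<^sup>2 * (V * (P - (C * Q + A * Q) * ((1 - U) * P') + C * Q * (A * Q) * ((1 - U) * (1 - U * R) * P''))
       - (1 + A * B * Q) * P + A * B * Q * (U * P) + A * Q * (B + C) * ((1 - U) * P'))"
proof -
  have a: "X * ((1 - U) * P') = (1 - U) * P"
    using assms(3) by (simp add: algebra_simps)
  have b: "X\<^sup>2 * ((1 - U) * (1 - U * R) * P'') = (1 - U) * (1 - U * R) * P"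
    using assms(4) by (simp add: right_diff_distrib mult.left_commute)
  have "X\<^sup>2 * (V * (P - (C * Q + A * Q) * ((1 - U) * P') + C * Q * (A * Q) * ((1 - U) * (1 - U * R) * P''))
       - (1 + A * B * Q) * P + A * B * Q * (U * P) + A * Q * (B + C) * ((1 - U) * P'))
    = X\<^sup>2 * V * P - X * V * (C * Q + A * Q) * (X * ((1 - U) * P'))
      + V * C * Q * (A * Q) * (X\<^sup>2 * ((1 - U) * (1 - U * R) * P''))
      - X\<^sup>2 * (1 + A * B * Q) * P + X\<^sup>2 * A * B * Q * U * P
      + X * A * Q * (B + C) * (X * ((1 - U) * P'))"
    by (simp add: algebra_simps power2_eq_square)
  also have "\<dots> = X\<^sup>2 * V * P - X * (V * (1 - U)) * (C * Q + A * Q) * P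
      + C * Q * A * (Q * (V * (1 - U)) * (1 - U * R)) * P
      - X\<^sup>2 * (1 + A * B * Q) * P + X\<^sup>2 * A * B * Q * U * P
      + X * A * Q * (B + C) * (1 - U) * P"
    unfolding a b by (simp only: mult_ac)
  also have "V * (1 - U) = V - 1"
    using assms(1) by (simp add: right_diff_distrib)
  also have "Q * (V - 1) * (1 - U * R) = Q * V - Q - 1 + U"
  proof -
    have "Q * (V - 1) * (1 - U * R) = Q * V - Q - (V * U) * (R * Q) + U * (R * Q)"
      by (simp add: algebra_simps)
    then show ?thesis using assms(1,2) by simp
  qed
  finally show ?thesis
    by (simp add: algebra_simps power2_eq_square)
qed

lemma qdiff_power: "qdiff (XX ^ n) = XX\<^sup>2 * jacobi_poly_op (\<lambda>n. XX ^ n) n"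
proof -
  let ?U = "cst qq ^ n" and ?V = "cst rr ^ n" and ?R = "cst rr"
  let ?P' = "XX ^ (n - 1) :: ser poly" and ?P'' = "XX ^ (n - 2) :: ser poly"
  have RQ: "cst rr * cst qq = 1"
    unfolding cst_mult[symmetric] rr_qq by (simp add: one_pCons)
  have VU: "?V * ?U = 1"
    using RQ by (simp flip: power_mult_distrib)
  have s1: "qshift (cst qq) (\<lambda>_. 1) (\<lambda>n. XX ^ n) n = (1 - ?U) * ?P'"
    by (cases n) simp_all
  have cases: "n = 0 \<or> n = 1 \<or> (\<exists>m. n = Suc (Suc m))"
    by (metis One_nat_def not0_implies_Suc)
  \<comment> \<open>Where the exponent \<open>n - 2\<close> is truncated, \<open>1 - ?U\<close> (for
    \<open>n = 0\<close>) or \<open>1 - ?U * ?R\<close> (for \<open>n = 1\<close>) is zero.\<close>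
  have s2: "qshift (cst qq) (\<lambda>_. 1) (qshift (cst qq) (\<lambda>_. 1) (\<lambda>n. XX ^ n)) n = (1 - ?U) * (1 - ?U * ?R) * ?P''"
    using cases
  proof (elim disjE exE)
    assume n: "n = 1"
    have "1 - ?U * ?R = 0"
      using RQ by (simp only: n power_one_right mult.commute[of "cst qq"] diff_self)
    then show ?thesis
      by (simp only: n One_nat_def qshift_Suc qshift_0 mult_zero_right mult_zero_left)
  next
    fix m assume n: "n = Suc (Suc m)"
    have "?U * ?R = cst qq ^ Suc m * (cst rr * cst qq)"
      by (simp only: n power_Suc mult_ac)
    then have "?U * ?R = cst qq ^ Suc m" unfolding RQ by (simp only: mult_1_right)
    then show ?thesis
      by (simp only: n qshift_Suc mult_1 mult.assoc diff_Suc_Suc diff_0 numeral_2_eq_2) simp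
  qed simp
  have e1: "(1 - ?U) * (XX ^ n - XX * ?P') = 0"
    by (cases n) simp_all
  have e2: "(1 - ?U) * (1 - ?U * ?R) * (XX ^ n - XX\<^sup>2 * ?P'') = 0"
    using cases
  proof (elim disjE exE)
    assume "n = 1"
    then have "1 - ?U * ?R = 0"
      using RQ by (simp only: power_one_right mult.commute[of "cst qq"] diff_self)
    then show ?thesis by (simp only: mult_zero_right mult_zero_left)
  next
    fix m assume "n = Suc (Suc m)"
    then have "XX ^ n = XX\<^sup>2 * (?P'' :: ser poly)"
      by (simp only: flip: power_add) simp
    then show ?thesis by (simp only: diff_self mult_zero_right)
  qed simp
  have comp: "pcompose (XX ^ n) [:0, x:] = cst x ^ n * XX ^ n" for x :: ser
  proof -
    have "pcompose (XX ^ n) [:0, x:] = (cst x * XX) ^ n"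
      unfolding pcompose_power pcompose_XX by (simp add: XX_def)
    then show ?thesis by (simp only: power_mult_distrib)
  qed
  show ?thesis
    unfolding qdiff_def comp band_op_def s1 s2 cst_hom
    by (rule qdiff_power_identity[OF VU RQ e1 e2])
qed

lemma qshift_sum: "qshift q s (\<lambda>n. \<Sum>x\<in>A. f x n) = (\<lambda>n. \<Sum>x\<in>A. qshift q s (f x) n)"
  by (auto simp: fun_eq_iff qshift_def sum_distrib_left split: nat.split)

lemma band_op_sum:
  "band_op q r x y z p K s (\<lambda>n. \<Sum>i\<in>A. f i n) n = (\<Sum>i\<in>A. band_op q r x y z p K s (f i) n)"
  by (simp add: band_op_def qshift_sum sum.distrib sum_subtractf sum_distrib_left algebra_simps)

text \<open>The operator acts on the index \<open>n\<close> only, so a fixed polynomial factors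
  out.\<close>

lemma jacobi_poly_op_smult: "jacobi_poly_op (\<lambda>n. smult (f n) P) n = smult (jacobi_op (\<lambda>_. 1) f n) P"
proof -
  have qshift: "qshift (cst qq) (\<lambda>_. 1) (\<lambda>n. cst (g n) * P) = (\<lambda>n. cst (qshift qq (\<lambda>_. 1) g n) * P)" for g
    unfolding fun_eq_iff
  proof
    fix n
    show "qshift (cst qq) (\<lambda>_. 1) (\<lambda>n. cst (g n) * P) n = cst (qshift qq (\<lambda>_. 1) g n) * P"
      by (cases n) (simp_all only: qshift_0 qshift_Suc cst_hom mult_1 mult.assoc, simp)
  qed
  show ?thesis
    unfolding smult_cst band_op_def qshift cst_hom by (simp only: algebra_simps mult_1_left mult_1_right)
qed

lemma band_op_low:
  assumes "\<And>m. m < n \<Longrightarrow> f m = 0"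
  shows "band_op q r x y z p K s f n = (r ^ n - K + p * q ^ n) * f n"
proof -
  have "qshift q s f n = 0"
    by (cases n) (simp_all add: assms)
  moreover have "qshift q s (qshift q s f) n = 0"
  proof (cases n)
    case (Suc m)
    then show ?thesis by (cases m) (simp_all add: assms)
  qed simp
  ultimately show ?thesis by (simp add: band_op_def algebra_simps)
qed

section \<open>Distinct eigenvalues and uniqueness of eigenpolynomials\<close>

lemma coeff3_0_mult: "coeff3 (f * g) 0 0 0 = coeff3 f 0 0 0 * coeff3 g 0 0 0"
  by (simp add: coeff3_def)

lemma coeff3_0_simps:
  "coeff3 (f - g) 0 0 0 = coeff3 f 0 0 0 - coeff3 g 0 0 0"
  "coeff3 (f + g) 0 0 0 = coeff3 f 0 0 0 + coeff3 g 0 0 0"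
  "coeff3 1 0 0 0 = 1" "coeff3 aa 0 0 0 = 0" "coeff3 cc 0 0 0 = 0"
  "coeff3 (scal c) 0 0 0 = c" "coeff3 qq 0 0 0 = q0"
  by (simp_all add: coeff3_def aa_def cc_def qq_def scal_def)

lemma coeff3_0_power: "coeff3 (f ^ n) 0 0 0 = coeff3 f 0 0 0 ^ n"
  by (induction n) (simp_all add: coeff3_0_mult coeff3_0_simps)

lemma coeff3_0_qpoch:
  "coeff3 (qpoch z q k) 0 0 0 = qpoch (coeff3 z 0 0 0) (coeff3 q 0 0 0) k"
  by (induction k)
    (simp_all add: qpoch_def coeff3_0_mult coeff3_0_simps coeff3_0_power)

lemma q0_power: "q0 ^ n = Fract (monom 1 n) 1"
  by (induction n) (simp_all add: q0_def One_fract_def monom_Suc monom_0 one_pCons)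

lemma q0_power_inj: "q0 ^ m = q0 ^ n \<longleftrightarrow> m = n"
  by (simp add: q0_power eq_fract monom_eq_iff')

text \<open>At a = b = c = 0 the eigenvalue is q^-n - 1.\<close>

lemma eigen_inj: "eigen m = eigen n \<longleftrightarrow> m = n"
proof
  assume "eigen m = eigen n"
  then have "coeff3 (eigen m) 0 0 0 = coeff3 (eigen n) 0 0 0" by simp
  then have "inverse (q0 ^ m) = inverse (q0 ^ n)"
    by (simp add: eigen_def coeff3_0_simps coeff3_0_power coeff3_0_mult power_inverse)
  then show "m = n" by (simp add: q0_power_inj)
qed simp

text \<open>On monomials x^-2 \<open>qdiff\<close> is triangular with diagonal
  \<open>eigen\<close>.\<close>

lemma coeff_qdiff_top:
  assumes "degree z \<le> d"
  shows "coeff (qdiff z) (d + 2) = eigen d * coeff z d"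
proof -
  have sh0: "coeff (qshift (cst qq) (\<lambda>_. 1) f i) d = 0" if "i \<le> d" "\<And>m. m < i \<Longrightarrow> coeff (f m) d = 0"
    for f :: "nat \<Rightarrow> ser poly" and i
  proof (cases i)
    case (Suc m)
    have "qshift (cst qq) (\<lambda>_. 1) f i = cst (1 - qq ^ i) * f m"
      by (simp only: Suc qshift_Suc cst_hom mult_1)
    then show ?thesis using that Suc by simp
  qed simp
  have pw: "coeff (XX ^ m :: ser poly) d = (if m = d then 1 else 0)" for m
    by (simp add: XX_def flip: monom_altdef[of 1, simplified])
  have top: "coeff (jacobi_poly_op (\<lambda>n. XX ^ n) i) d = (if i = d then eigen d else 0)" if "i \<le> d" for i
  proof -
    let ?s = "qshift (cst qq) (\<lambda>_. 1) (\<lambda>n. XX ^ n)"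
    have s1: "coeff (?s j) d = 0" if "j \<le> d" for j
      using that pw by (intro sh0) auto
    have s2: "coeff (qshift (cst qq) (\<lambda>_. 1) ?s i) d = 0"
      using that s1 by (intro sh0 s1) auto
    have "jacobi_poly_op (\<lambda>n. XX ^ n) i = smult (eigen i) (XX ^ i)
       + smult (rr ^ i * (cc * qq * (aa * qq))) (qshift (cst qq) (\<lambda>_. 1) ?s i)
       + smult (aa * qq * (bb + cc) - rr ^ i * (cc * qq + aa * qq)) (?s i)"
      unfolding band_op_def eigen_def smult_cst cst_hom by (simp only: algebra_simps mult_1_left mult_1_right)
    then show ?thesis using that s1 s2 pw by simp
  qed
  have z: "z = (\<Sum>i\<le>d. smult (coeff z i) (XX ^ i))"
    using assms by (subst poly_as_sum_of_monoms'[symmetric, of _ d]) (simp_all add: monom_altdef XX_def)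
  have qz: "qdiff z = XX\<^sup>2 * (\<Sum>i\<le>d. smult (coeff z i) (jacobi_poly_op (\<lambda>n. XX ^ n) i))"
    by (subst z, unfold smult_cst qdiff_sum qdiff_cst qdiff_power)
      (simp only: sum_distrib_left mult.left_commute)
  have "coeff (qdiff z) (d + 2) = (\<Sum>i\<le>d. coeff z i * coeff (jacobi_poly_op (\<lambda>n. XX ^ n) i) d)"
    unfolding qz by (simp add: XX_def power2_eq_square coeff_sum)
  also have "\<dots> = (\<Sum>i\<le>d. if i = d then coeff z i * eigen d else 0)"
    by (intro sum.cong) (simp_all add: top)
  finally show ?thesis by (simp add: mult.commute)
qed

text \<open>The leading coefficient would force \<open>eigen (degree z) = eigen n\<close> with
  \<open>degree z < n\<close>.\<close>

lemma qdiff_eigen_unique: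
  assumes "qdiff z = XX\<^sup>2 * (cst (eigen n) * z)" "\<And>m. m \<ge> n \<Longrightarrow> coeff z m = 0"
  shows "z = 0"
proof (rule ccontr)
  assume "z \<noteq> 0"
  let ?d = "degree z"
  have lc: "coeff z ?d \<noteq> 0" using \<open>z \<noteq> 0\<close> by simp
  then have "?d < n" using assms(2) by (meson not_le)
  have "coeff (qdiff z) (?d + 2) = eigen n * coeff z ?d"
    unfolding assms(1) by (simp add: XX_def power2_eq_square)
  then show False
    using coeff_qdiff_top[of z ?d] lc \<open>?d < n\<close> eigen_inj[of ?d n] by simp
qed

section \<open>Mixed moments\<close>

lemma cst_qpoch: "qpoch (cst z) (cst q) k = cst (qpoch z q k)"
  unfolding qpoch_def by (induction k) (simp_all only: lessThan_0 prod.empty prod.lessThan_Suc cst_hom)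

lemma rr_power: "scal (inverse (q0 ^ n)) = rr ^ n"
  by (induction n) (simp_all add: scal_1 scal_mult)

definition denom :: "nat \<Rightarrow> ser" where
  "denom j = qpoch qq qq j * qpoch (aa * qq) qq j * qpoch (cc * qq) qq j"

definition jcoeff :: "nat \<Rightarrow> nat \<Rightarrow> ser" where
  "jcoeff n j = qpoch (aa * qq) qq n * qpoch (cc * qq) qq n *
     inverse (qpoch (aa * bb * qq ^ (n + 1)) qq n) *
     (inverse (denom j) * (qpoch (rr ^ n) qq j * qpoch (aa * bb * qq ^ (n + 1)) qq j * qq ^ j))"

text \<open>The factor with index \<open>n\<close> is 1 - q^-n q^n = 0; this terminates the
  hypergeometric series.\<close>

lemma qpoch_eq_0: "n < k \<Longrightarrow> qpoch (rr ^ n) qq k = 0"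
  unfolding qpoch_def by (rule prod_zero) (auto intro!: bexI[of _ n] simp: rr_qq_power)

lemma big_q_Jacobi_expand: "big_q_Jacobi n = (\<Sum>j\<le>n. smult (jcoeff n j) (xpoch j))"
proof -
  let ?t = "\<lambda>k. smult (inverse (qpoch qq qq k * qpoch (aa * qq) qq k * qpoch (cc * qq) qq k))
       (qpoch [:scal (inverse (q0 ^ n)):] [:qq:] k * qpoch [:aa * bb * qq ^ (n + 1):] [:qq:] k *
          qpoch [:0, 1:] [:qq:] k) * [:qq:] ^ k"
  have t: "?t k = smult (inverse (denom k) *
     (qpoch (rr ^ n) qq k * qpoch (aa * bb * qq ^ (n + 1)) qq k * qq ^ k)) (xpoch k)" for k
    unfolding rr_power XX_def[symmetric] cst_qpoch denom_def[symmetric] smult_cst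
    by (simp only: cst_mult cst_power mult_ac)
  have "{k. ?t k \<noteq> 0} \<subseteq> {..n}"
    unfolding t by (rule subsetI, rule ccontr) (simp add: qpoch_eq_0)
  then have sum: "Sum_any ?t = sum ?t {..n}"
    by (intro Sum_any.expand_superset) auto
  show ?thesis
    unfolding big_q_Jacobi_def phi32_def sum unfolding t unfolding jcoeff_def smult_cst cst_mult sum_distrib_left
    by (simp only: mult_ac)
qed

lemma coeff3_0_denom: "coeff3 (denom j) 0 0 0 \<noteq> 0"
proof -
  have "q0 * q0 ^ i \<noteq> 1" for i
    using q0_power_inj[of "Suc i" 0] by simp
  then show ?thesis
    by (simp add: denom_def coeff3_0_mult coeff3_0_qpoch coeff3_0_simps) (simp add: qpoch_def)
qed

text \<open>The eigenvalue equation compared at (x;q)_j: \<open>lower\<close> cancels the new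
  denominators, and the new numerator factors produce the difference of eigenvalues.\<close>

lemma jcoeff_Suc: "jcoeff n (Suc j) * lower (Suc j) = (eigen n - eigen j) * jcoeff n j"
proof -
  let ?d = "(1 - qq * qq ^ j) * (1 - aa * qq * qq ^ j) * (1 - cc * qq * qq ^ j)"
  let ?I = "\<lambda>j. inverse (denom j)"
  let ?C = "qpoch (aa * qq) qq n * qpoch (cc * qq) qq n * inverse (qpoch (aa * bb * qq ^ (n + 1)) qq n)"
  let ?N = "qpoch (rr ^ n) qq j * qpoch (aa * bb * qq ^ (n + 1)) qq j * qq ^ j"
  let ?f = "(1 - rr ^ n * qq ^ j) * (1 - aa * bb * qq ^ (n + 1) * qq ^ j)"
  have dS: "denom (Suc j) = denom j * ?d"
    by (simp add: denom_def qpoch_Suc mult_ac)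
  have "?I (Suc j) * ?d = ?I (Suc j) * ?d * (?I j * denom j)"
    by (simp add: inverse_ser coeff3_0_denom)
  also have "\<dots> = (?I (Suc j) * denom (Suc j)) * ?I j"
    unfolding dS by (simp only: mult_ac)
  finally have I: "?I (Suc j) * ?d = ?I j"
    by (simp add: inverse_ser coeff3_0_denom)
  have l: "lower (Suc j) = - (rr ^ Suc j * ?d)"
    by (simp add: lower_def mult_ac)
  have f: "- (rr ^ j * ?f) = eigen n - eigen j"
  proof -
    have "- (rr ^ j * ?f) = - (rr ^ j) + rr ^ n * (rr ^ j * qq ^ j) + aa * bb * qq ^ (n + 1) * (rr ^ j * qq ^ j)
       - aa * bb * qq * qq ^ j * (rr ^ n * qq ^ n) * (rr ^ j * qq ^ j)"
      by (simp add: algebra_simps)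
    then show ?thesis unfolding rr_qq_power by (simp add: eigen_def algebra_simps)
  qed
  have r: "rr ^ Suc j * qq = rr ^ j"
    using rr_qq by (simp add: mult.assoc mult.left_commute[of _ "rr ^ j"] mult.commute[of rr])
  have "jcoeff n (Suc j) * lower (Suc j) = ?C * (?I (Suc j) * ?d) * ?N * - ((rr ^ Suc j * qq) * ?f)"
    unfolding jcoeff_def l qpoch_Suc by (simp add: mult_ac)
  also have "\<dots> = (eigen n - eigen j) * jcoeff n j"
    unfolding I r f jcoeff_def by (simp only: mult_ac)
  finally show ?thesis .
qed

lemma qdiff_big_q_Jacobi: "qdiff (big_q_Jacobi n) = XX\<^sup>2 * (cst (eigen n) * big_q_Jacobi n)"
proof -
  let ?l = "\<lambda>j. cst (jcoeff n j * lower j) * xpoch (j - 1)"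
  have l0: "?l 0 = 0" by (simp add: lower_0)
  have "(\<Sum>j\<le>n. ?l j) = (\<Sum>j<n. ?l (Suc j))"
    unfolding sum.atMost_shift l0 by simp
  also have "\<dots> = (\<Sum>j<n. cst ((eigen n - eigen j) * jcoeff n j) * xpoch j)"
    by (simp add: jcoeff_Suc)
  \<comment> \<open>The summand \<open>j = n\<close> may be added because its factor
    \<open>eigen n - eigen n\<close> is zero.\<close>
  also have "\<dots> = (\<Sum>j\<le>n. cst ((eigen n - eigen j) * jcoeff n j) * xpoch j)"
    by (simp flip: lessThan_Suc_atMost)
  finally have l: "(\<Sum>j\<le>n. ?l j) = (\<Sum>j\<le>n. cst ((eigen n - eigen j) * jcoeff n j) * xpoch j)" .
  have "qdiff (big_q_Jacobi n) =
     (\<Sum>j\<le>n. XX\<^sup>2 * (cst (jcoeff n j * eigen j) * xpoch j + ?l j))"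
    unfolding big_q_Jacobi_expand smult_cst qdiff_sum qdiff_cst qdiff_xpoch cst_mult
    by (simp only: algebra_simps mult_1_left mult_1_right)
  also have "\<dots> = XX\<^sup>2 * (\<Sum>j\<le>n. cst (jcoeff n j * eigen j) * xpoch j
       + cst ((eigen n - eigen j) * jcoeff n j) * xpoch j)"
    unfolding sum_distrib_left[symmetric] sum.distrib l ..
  also have "\<dots> = XX\<^sup>2 * (\<Sum>j\<le>n. cst (eigen n) * (cst (jcoeff n j) * xpoch j))"
    unfolding cst_hom by (simp only: algebra_simps mult_1_left mult_1_right) simp
  finally show ?thesis
    unfolding big_q_Jacobi_expand smult_cst sum_distrib_left .
qed

lemma coeff_xpoch:
  "coeff (xpoch j) j = (\<Prod>i<j. - (qq ^ i))" "j < m \<Longrightarrow> coeff (xpoch j) m = 0"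
proof -
  have rec: "xpoch (Suc j) = xpoch j - smult (qq ^ j) (pCons 0 (xpoch j))" for j
    unfolding qpoch_Suc smult_cst cst_power by (simp add: XX_def algebra_simps)
  have above: "coeff (xpoch j) m = 0" if "j < m" for j m
    using that
  proof (induction j arbitrary: m)
    case (Suc j)
    then show ?case unfolding rec by (cases m) simp_all
  qed (simp add: qpoch_def)
  show "coeff (xpoch j) j = (\<Prod>i<j. - (qq ^ i))"
  proof (induction j)
    case (Suc j)
    then show ?case unfolding rec using above[of j "Suc j"] by simp
  qed (simp add: qpoch_def)
  show "j < m \<Longrightarrow> coeff (xpoch j) m = 0" by (rule above)
qed

lemma coeff_big_q_Jacobi_above: "n < m \<Longrightarrow> coeff (big_q_Jacobi n) m = 0"
  by (simp add: big_q_Jacobi_expand coeff_sum coeff_xpoch(2))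

text \<open>After reversing the product, the i-th factors combine to (1 - q^(-i-1)) q (-q^i) = 1 -
  q^(i+1).\<close>

lemma qpoch_reflect: "qpoch (rr ^ n) qq n * qq ^ n * (\<Prod>i<n. - (qq ^ i)) = qpoch qq qq n"
proof -
  have "qpoch (rr ^ n) qq n = (\<Prod>i<n. 1 - rr ^ n * qq ^ (n - Suc i))"
    unfolding qpoch_def by (rule prod.nat_diff_reindex[symmetric])
  also have "\<dots> = (\<Prod>i<n. 1 - rr ^ Suc i)"
  proof (rule prod.cong)
    fix i assume "i \<in> {..<n}"
    then have "rr ^ n * qq ^ (n - Suc i) = rr ^ Suc i * (rr ^ (n - Suc i) * qq ^ (n - Suc i))"
      by (simp del: power_Suc flip: power_add mult.assoc)
    then show "1 - rr ^ n * qq ^ (n - Suc i) = 1 - rr ^ Suc i"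
      unfolding rr_qq_power by simp
  qed simp
  finally have "qpoch (rr ^ n) qq n * qq ^ n * (\<Prod>i<n. - (qq ^ i))
     = (\<Prod>i<n. (1 - rr ^ Suc i) * qq * - (qq ^ i))"
    by (simp only: prod.distrib prod_constant card_lessThan)
  also have "\<dots> = (\<Prod>i<n. 1 - qq * qq ^ i)"
  proof (rule prod.cong)
    fix i
    have "(1 - rr ^ Suc i) * qq * - (qq ^ i) = rr ^ Suc i * qq ^ Suc i - qq * qq ^ i"
      by (simp add: algebra_simps)
    then show "(1 - rr ^ Suc i) * qq * - (qq ^ i) = 1 - qq * qq ^ i"
      unfolding rr_qq_power .
  qed simp
  finally show ?thesis by (simp add: qpoch_def)
qed

text \<open>Only \<open>j = n\<close> contributes, and by \<open>qpoch_reflect\<close> the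
  normalising prefactor cancels everything.\<close>

lemma coeff_big_q_Jacobi_top: "coeff (big_q_Jacobi n) n = 1"
proof -
  let ?E = "qpoch (aa * bb * qq ^ (n + 1)) qq n"
  have E: "inverse ?E * ?E = 1"
    by (rule inverse_ser)
      (simp add: coeff3_0_qpoch coeff3_0_mult coeff3_0_simps coeff3_0_power, simp add: qpoch_def)
  have D: "inverse (denom n) * denom n = 1"
    by (rule inverse_ser) (rule coeff3_0_denom)
  have "coeff (big_q_Jacobi n) n = (\<Sum>j\<in>{n}. jcoeff n j * coeff (xpoch j) n)"
    unfolding big_q_Jacobi_expand coeff_sum coeff_smult
    by (intro sum.mono_neutral_right) (auto simp: coeff_xpoch(2))
  also have "\<dots> = (inverse ?E * ?E) * (inverse (denom n) *
      ((qpoch (rr ^ n) qq n * qq ^ n * (\<Prod>i<n. - (qq ^ i))) * qpoch (aa * qq) qq n * qpoch (cc * qq) qq n))"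
    by (simp add: coeff_xpoch(1) jcoeff_def mult_ac)
  also have "\<dots> = 1"
    unfolding qpoch_reflect denom_def[symmetric] E D by simp
  finally show ?thesis .
qed

lemma big_q_Jacobi_independent:
  assumes "(\<Sum>k\<le>n. smult (s k) (big_q_Jacobi k)) = 0" "k \<le> n"
  shows "s k = 0"
  using assms
proof (induction n)
  case 0
  have "s 0 = coeff (\<Sum>k\<le>0. smult (s k) (big_q_Jacobi k)) 0"
    by (simp add: coeff_big_q_Jacobi_top)
  then show ?case using 0(2) unfolding 0(1) by simp
next
  case (Suc n)
  have "coeff (\<Sum>k\<le>Suc n. smult (s k) (big_q_Jacobi k)) (Suc n) = s (Suc n)"
    by (simp add: coeff_sum coeff_big_q_Jacobi_top coeff_big_q_Jacobi_above)
  then have "s (Suc n) = 0" unfolding Suc.prems(1) by simp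
  then show ?case
    using Suc by (cases "k = Suc n") auto
qed

text \<open>The sums and the monomials obey the same relation between \<open>qdiff\<close> and M. By
  induction their difference vanishes at smaller indices, so at \<open>n\<close> it is an
  eigenpolynomial for \<open>eigen n\<close> of degree below \<open>n\<close>, hence zero.\<close>

lemma sum_h_big_q_Jacobi:
  assumes "n \<le> M"
  shows "(\<Sum>k\<le>M. smult (h wt n k) (big_q_Jacobi k)) = XX ^ n"
  using assms
proof (induction n rule: less_induct)
  case (less n)
  \<comment> \<open>The upper limit does not depend on the index, so \<open>Y\<close> is one
    sequence on which the operator acts termwise.\<close>
  define Y where "Y = (\<lambda>n. \<Sum>k\<le>M. smult (h wt n k) (big_q_Jacobi k))"
  have "qdiff (Y n) = XX\<^sup>2 * (\<Sum>k\<le>M. smult (eigen k * h wt n k) (big_q_Jacobi k))"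
    unfolding Y_def smult_cst qdiff_sum qdiff_cst qdiff_big_q_Jacobi cst_mult sum_distrib_left
    by (simp only: mult_ac)
  also have "(\<Sum>k\<le>M. smult (eigen k * h wt n k) (big_q_Jacobi k)) = jacobi_poly_op Y n"
    unfolding Y_def band_op_sum jacobi_poly_op_smult jacobi_op_h ..
  finally have "qdiff (Y n - XX ^ n) = XX\<^sup>2 * (jacobi_poly_op Y n - jacobi_poly_op (\<lambda>n. XX ^ n) n)"
    unfolding qdiff_diff qdiff_power by (simp only: algebra_simps mult_1_left mult_1_right)
  also have "jacobi_poly_op Y n - jacobi_poly_op (\<lambda>n. XX ^ n) n = jacobi_poly_op (\<lambda>n. Y n - XX ^ n) n"
    unfolding band_op_diff ..
  also have "\<dots> = cst (eigen n) * (Y n - XX ^ n)"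
  proof -
    have "Y m - XX ^ m = 0" if "m < n" for m
      using less.IH[OF that] that less.prems by (simp add: Y_def)
    then have "jacobi_poly_op (\<lambda>n. Y n - XX ^ n) n
      = (cst rr ^ n - cst (1 + aa * bb * qq) + cst (aa * bb * qq) * cst qq ^ n) * (Y n - XX ^ n)"
      by (rule band_op_low)
    then show ?thesis unfolding eigen_def by (simp only: cst_hom)
  qed
  finally have "qdiff (Y n - XX ^ n) = XX\<^sup>2 * (cst (eigen n) * (Y n - XX ^ n))" .
  \<comment> \<open>\<open>h\<close> is unitriangular and the polynomials are monic, so
    \<open>Y n\<close> is monic of degree \<open>n\<close>.\<close>
  moreover have "coeff (Y n - XX ^ n) m = 0" if "n \<le> m" for m
  proof -
    have "coeff (Y n) m = (\<Sum>k\<le>M. if k = n then (if m = n then 1 else 0) else 0)"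
      unfolding Y_def coeff_sum
    proof (rule sum.cong)
      fix k
      show "coeff (smult (h wt n k) (big_q_Jacobi k)) m = (if k = n then (if m = n then 1 else 0) else 0)"
        using that h_low[of n k] coeff_big_q_Jacobi_above[of k m] coeff_big_q_Jacobi_top[of n]
        by (cases n k rule: linorder_cases) auto
    qed simp
    moreover have "coeff (XX ^ n) m = (if m = n then 1 else 0)"
      by (simp add: XX_def flip: monom_altdef[of 1, simplified])
    ultimately show ?thesis using less.prems by simp
  qed
  ultimately have "Y n - XX ^ n = 0" by (rule qdiff_eigen_unique)
  then show ?case by (simp add: Y_def)
qed

lemma mixed_moment_eq: "mixed_moment n = h wt n"
  unfolding mixed_moment_def
proof (rule the_equality)
  show "(\<forall>k>n. h wt n k = 0) \<and> [:0, 1:] ^ n = (\<Sum>k\<le>n. smult (h wt n k) (big_q_Jacobi k))"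
    using h_low[of n] sum_h_big_q_Jacobi[of n n] by (simp add: XX_def)
next
  fix s
  assume s: "(\<forall>k>n. s k = 0) \<and> [:0, 1:] ^ n = (\<Sum>k\<le>n. smult (s k) (big_q_Jacobi k))"
  have "(\<Sum>k\<le>n. smult (s k - h wt n k) (big_q_Jacobi k)) = 0"
    using s sum_h_big_q_Jacobi[of n n] by (simp add: smult_diff_left sum_subtractf XX_def)
  note independent = big_q_Jacobi_independent[OF this]
  show "s = h wt n"
  proof
    fix k
    show "s k = h wt n k"
      using s h_low[of n k] independent[of k] by (cases "k \<le> n") auto
  qed
qed

theorem proposition4p20:
  fixes n k :: nat
  assumes "k \<le> n"
  shows "formally_summable (path_weight wt) (SE k n) \<and> mixed_moment n k = h wt n k"
  by (simp add: formally_summable_path_weight mixed_moment_eq)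

end
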